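(* Let $\lambda>0$, $s\ge2$, let $(Y_i)_{i=1}^s$ be i.i.d. from $P_0$, and let $$I=\big\langle\Sigma_{0,\lambda}^{-1/2}\Sigma_0\Sigma_{0,\lambda}^{-1/2},\ \Sigma_{0,\lambda}^{-1/2}(\hat\Sigma_0-\Sigma_0)\Sigma_{0,\lambda}^{-1/2}\big\rangle_{\mathcal L^2(\mathscr H)}.$$ Then for any $\delta>0$, $$P_0^s\left\{(Y_i)_{i=1}^s:\ |I|\le\frac{4\kappa\log\frac2\delta}{\lambda s}+\sqrt{\frac{12\kappa\,\mathcal N_2^2(\lambda)\log\frac2\delta}{\lambda s}}\right\}\ge1-\delta .$$ Furthermore, if $C:=\sup_i\|\phi_i\|_\infty<\infty$, then $$P_0^s\left\{(Y_i)_{i=1}^s:\ |I|\le\frac{4C^2\mathcal N_1(\lambda)\log\frac2\delta}{s}+\sqrt{\frac{12C^2\mathcal N_1(\lambda)\mathcal N_2^2(\lambda)\log\frac2\delta}{s}}\right\}\ge1-\delta .$$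
   Context: $(\mathcal X,\mathcal B)$ is a second countable space with its Borel $\sigma$-algebra; $\mathscr H$ is an RKHS of real functions on $\mathcal X$ with continuous reproducing kernel $K$, $\sup_xK(x,x)\le\kappa$. $P_0$ is a probability measure on $\mathcal X$, $\mu_0=\int K(\cdot,x)\,dP_0(x)$. $\mathfrak I:\mathscr H\to L^2(P_0)$, $f\mapsto[f-\mathbb E_{P_0}f]_\sim$, with adjoint $\mathfrak I^*$; $\mathcal T=\mathfrak I\mathfrak I^*=\sum_i\lambda_i\,\tilde\phi_i\otimes\tilde\phi_i$ on $L^2(P_0)$ (infinitely many positive decreasing eigenvalues $\lambda_i$, orthonormal $\tilde\phi_i$); $\phi_i=\lambda_i^{-1}\mathfrak I^*\tilde\phi_i\in\mathscr H$, $\|\phi_i\|_\infty=\sup_x|\phi_i(x)|$. $\Sigma_0=\mathfrak I^*\mathfrak I=\int(K(\cdot,x)-\mu_0)\otimes_{\mathscr H}(K(\cdot,x)-\mu_0)\,dP_0(x)$, $\Sigma_{0,\lambda}=\Sigma_0+\lambda I$ (here $I$ inside $\Sigma_{0,\lambda}$ is the identity), $\mathcal N_1(\lambda)=\mathrm{Tr}(\Sigma_{0,\lambda}^{-1/2}\Sigma_0\Sigma_{0,\lambda}^{-1/2})$, $\mathcal N_2(\lambda)=\|\Sigma_{0,\lambda}^{-1/2}\Sigma_0\Sigma_{0,\lambda}^{-1/2}\|_{\mathcal L^2(\mathscr H)}$. $\hat\Sigma_0=\frac1{2s(s-1)}\sum_{i\ne j}(K(\cdot,Y_i)-K(\cdot,Y_j))\otimes_{\mathscr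 H}(K(\cdot,Y_i)-K(\cdot,Y_j))$. $\langle\cdot,\cdot\rangle_{\mathcal L^2(\mathscr H)}$, $\|\cdot\|_{\mathcal L^2(\mathscr H)}$ are the Hilbert–Schmidt inner product and norm. *)

theory Defs
  imports "HOL-Probability.Probability"
begin

text \<open>An RKHS of real functions on \<^typ>\<open>'x\<close> is a Hilbert space type \<^typ>\<open>'h\<close> together with an
  injective linear map \<open>evf\<close> sending each element to the function it is; \<open>evf f x\<close> is \<open>f(x)\<close>.\<close>

definition is_rkhs ::
  "('h::{real_inner,complete_space} \<Rightarrow> 'x \<Rightarrow> real) \<Rightarrow> ('x \<Rightarrow> 'x \<Rightarrow> real) \<Rightarrow> bool" where
  "is_rkhs evf K \<longleftrightarrow>
     (\<forall>x. linear (\<lambda>f. evf f x)) \<and> inj evf \<and>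
     (\<forall>y. \<exists>k. evf k = (\<lambda>x. K x y) \<and> (\<forall>f. evf f y = f \<bullet> k))"

definition ker_section :: "('h \<Rightarrow> 'x \<Rightarrow> real) \<Rightarrow> ('x \<Rightarrow> 'x \<Rightarrow> real) \<Rightarrow> 'x \<Rightarrow> 'h" where
  "ker_section evf K y = (THE k. evf k = (\<lambda>x. K x y))"

text \<open>Elements of \<open>L\<^sup>2(P)\<close> are handled through representatives; every notion below depends on
  them only up to equality almost everywhere.\<close>

definition L2_space :: "'x measure \<Rightarrow> ('x \<Rightarrow> real) set" where
  "L2_space P = {g \<in> borel_measurable P. integrable P (\<lambda>x. (g x)\<^sup>2)}"

definition L2_inner :: "'x measure \<Rightarrow> ('x \<Rightarrow> real) \<Rightarrow> ('x \<Rightarrow> real) \<Rightarrow> real" where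
  "L2_inner P g h = (\<integral>x. g x * h x \<partial>P)"

definition L2_norm :: "'x measure \<Rightarrow> ('x \<Rightarrow> real) \<Rightarrow> real" where
  "L2_norm P g = sqrt (L2_inner P g g)"

definition incl :: "('h \<Rightarrow> 'x \<Rightarrow> real) \<Rightarrow> 'x measure \<Rightarrow> 'h \<Rightarrow> 'x \<Rightarrow> real" where
  "incl evf P f = (\<lambda>x. evf f x - (\<integral>y. evf f y \<partial>P))"

definition incl_adj ::
  "('h::real_inner \<Rightarrow> 'x \<Rightarrow> real) \<Rightarrow> 'x measure \<Rightarrow> ('x \<Rightarrow> real) \<Rightarrow> 'h" where
  "incl_adj evf P g = (THE h. \<forall>f. f \<bullet> h = L2_inner P (incl evf P f) g)"

definition T_op ::
  "('h::real_inner \<Rightarrow> 'x \<Rightarrow> real) \<Rightarrow> 'x measure \<Rightarrow> ('x \<Rightarrow> real) \<Rightarrow> 'x \<Rightarrow> real" where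
  "T_op evf P g = incl evf P (incl_adj evf P g)"

text \<open>\<open>T = \<Sum>\<^sub>i lam\<^sub>i phit\<^sub>i \<otimes> phit\<^sub>i\<close> on \<open>L\<^sup>2(P)\<close>, with infinitely many terms.\<close>

definition eigen_expansion ::
  "'x measure \<Rightarrow> (('x \<Rightarrow> real) \<Rightarrow> 'x \<Rightarrow> real) \<Rightarrow> (nat \<Rightarrow> real) \<Rightarrow> (nat \<Rightarrow> 'x \<Rightarrow> real) \<Rightarrow> bool" where
  "eigen_expansion P T lam phit \<longleftrightarrow>
     (\<forall>i. 0 < lam i) \<and> decseq lam \<and>
     (\<forall>i. phit i \<in> L2_space P) \<and>
     (\<forall>i j. L2_inner P (phit i) (phit j) = (if i = j then 1 else 0)) \<and>
     (\<forall>g\<in>L2_space P.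
        (\<lambda>n. L2_norm P (\<lambda>x. T g x - (\<Sum>i<n. lam i * L2_inner P (phit i) g * phit i x)))
          \<longlonglongrightarrow> 0)"

definition eigfun ::
  "('h::real_inner \<Rightarrow> 'x \<Rightarrow> real) \<Rightarrow> 'x measure \<Rightarrow> (nat \<Rightarrow> real) \<Rightarrow> (nat \<Rightarrow> 'x \<Rightarrow> real) \<Rightarrow> nat \<Rightarrow> 'h" where
  "eigfun evf P lam phit i = (1 / lam i) *\<^sub>R incl_adj evf P (phit i)"

definition supnorm :: "('x \<Rightarrow> real) \<Rightarrow> ereal" where
  "supnorm f = (SUP x. ereal \<bar>f x\<bar>)"

definition pos_op :: "('h::real_inner \<Rightarrow>\<^sub>L 'h) \<Rightarrow> bool" where
  "pos_op A \<longleftrightarrow> (\<forall>f g. A f \<bullet> g = f \<bullet> A g) \<and> (\<forall>f. 0 \<le> A f \<bullet> f)"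

definition sqrt_op :: "('h::real_inner \<Rightarrow>\<^sub>L 'h) \<Rightarrow> ('h \<Rightarrow>\<^sub>L 'h)" where
  "sqrt_op A = (THE B. pos_op B \<and> B o\<^sub>L B = A)"

definition inv_op :: "('h::real_inner \<Rightarrow>\<^sub>L 'h) \<Rightarrow> ('h \<Rightarrow>\<^sub>L 'h)" where
  "inv_op A = (THE B. A o\<^sub>L B = id_blinfun \<and> B o\<^sub>L A = id_blinfun)"

definition orthonormal_basis :: "'h::real_inner set \<Rightarrow> bool" where
  "orthonormal_basis E \<longleftrightarrow>
     (\<forall>e\<in>E. norm e = 1) \<and> pairwise orthogonal E \<and> closure (span E) = UNIV"

text \<open>For trace class, resp. Hilbert--Schmidt, operators on a Hilbert space the following values do
  not depend on the orthonormal basis chosen.\<close>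

definition trace_op :: "('h::real_inner \<Rightarrow>\<^sub>L 'h) \<Rightarrow> real" where
  "trace_op A = (\<Sum>\<^sub>\<infinity>e\<in>(SOME E. orthonormal_basis E). A e \<bullet> e)"

definition hs_inner :: "('h::real_inner \<Rightarrow>\<^sub>L 'h) \<Rightarrow> ('h \<Rightarrow>\<^sub>L 'h) \<Rightarrow> real" where
  "hs_inner A B = (\<Sum>\<^sub>\<infinity>e\<in>(SOME E. orthonormal_basis E). A e \<bullet> B e)"

definition hs_norm :: "('h::real_inner \<Rightarrow>\<^sub>L 'h) \<Rightarrow> real" where
  "hs_norm A = sqrt (hs_inner A A)"

definition tensor_op :: "'h::real_inner \<Rightarrow> 'h \<Rightarrow> ('h \<Rightarrow>\<^sub>L 'h)" where
  "tensor_op a b = blinfun_scaleR_left a o\<^sub>L blinfun_inner_right b"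

lemma tensor_op_apply: "tensor_op a b f = (b \<bullet> f) *\<^sub>R a"
  by (simp add: tensor_op_def)

definition Sigma0 :: "('h::real_inner \<Rightarrow> 'x \<Rightarrow> real) \<Rightarrow> 'x measure \<Rightarrow> ('h \<Rightarrow>\<^sub>L 'h)" where
  "Sigma0 evf P = Blinfun (\<lambda>f. incl_adj evf P (incl evf P f))"

definition Sigma0_reg ::
  "('h::real_inner \<Rightarrow> 'x \<Rightarrow> real) \<Rightarrow> 'x measure \<Rightarrow> real \<Rightarrow> ('h \<Rightarrow>\<^sub>L 'h)" where
  "Sigma0_reg evf P l = Sigma0 evf P + l *\<^sub>R id_blinfun"

definition Sigma_hat ::
  "('h::real_inner \<Rightarrow> 'x \<Rightarrow> real) \<Rightarrow> ('x \<Rightarrow> 'x \<Rightarrow> real) \<Rightarrow> nat \<Rightarrow> (nat \<Rightarrow> 'x) \<Rightarrow> ('h \<Rightarrow>\<^sub>L 'h)" where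
  "Sigma_hat evf K s Y =
     (1 / (2 * real s * (real s - 1))) *\<^sub>R
       (\<Sum>i\<in>{1..s}. \<Sum>j\<in>{1..s} - {i}.
          tensor_op (ker_section evf K (Y i) - ker_section evf K (Y j))
                    (ker_section evf K (Y i) - ker_section evf K (Y j)))"

text \<open>\<open>\<Sigma>\<^sub>0\<^sub>,\<^sub>l\<^bsup>-1/2\<^esup> A \<Sigma>\<^sub>0\<^sub>,\<^sub>l\<^bsup>-1/2\<^esup>\<close>\<close>

definition whiten ::
  "('h::real_inner \<Rightarrow> 'x \<Rightarrow> real) \<Rightarrow> 'x measure \<Rightarrow> real \<Rightarrow> ('h \<Rightarrow>\<^sub>L 'h) \<Rightarrow> ('h \<Rightarrow>\<^sub>L 'h)" where
  "whiten evf P l A =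
     inv_op (sqrt_op (Sigma0_reg evf P l)) o\<^sub>L A o\<^sub>L inv_op (sqrt_op (Sigma0_reg evf P l))"

definition N1 :: "('h::real_inner \<Rightarrow> 'x \<Rightarrow> real) \<Rightarrow> 'x measure \<Rightarrow> real \<Rightarrow> real" where
  "N1 evf P l = trace_op (whiten evf P l (Sigma0 evf P))"

definition N2 :: "('h::real_inner \<Rightarrow> 'x \<Rightarrow> real) \<Rightarrow> 'x measure \<Rightarrow> real \<Rightarrow> real" where
  "N2 evf P l = hs_norm (whiten evf P l (Sigma0 evf P))"

definition I_stat ::
  "('h::real_inner \<Rightarrow> 'x \<Rightarrow> real) \<Rightarrow> ('x \<Rightarrow> 'x \<Rightarrow> real) \<Rightarrow> 'x measure \<Rightarrow> real \<Rightarrow> nat \<Rightarrow> (nat \<Rightarrow> 'x) \<Rightarrow> real" where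
  "I_stat evf K P l s Y =
     hs_inner (whiten evf P l (Sigma0 evf P)) (whiten evf P l (Sigma_hat evf K s Y - Sigma0 evf P))"

end

theory Submission
  imports Defs
begin

text \<open>Write \<open>B = \<Sigma>\<^sub>0\<^sub>,\<^sub>l\<^bsup>-1/2\<^esup>\<close>, \<open>A = B \<Sigma>\<^sub>0 B = 1 - l B\<^sup>2\<close> and \<open>u(x, y) = K(\<cdot>, x) - K(\<cdot>, y)\<close>. Since
  \<open>\<langle>f, \<Sigma>\<^sub>0 g\<rangle> = 1/2 E \<langle>f, u\<rangle> \<langle>g, u\<rangle>\<close> for an independent pair \<open>(x, y)\<close>, Parseval's identity gives
  \<open>I = U - E h\<close>, where \<open>U\<close> is the U-statistic with kernel \<open>h = 1/2 \<langle>A B u, B u\<rangle>\<close> and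
  \<open>E h = N\<^sub>2\<^sup>2\<close>. From \<open>0 \<le> A \<le> 1\<close> we get \<open>0 \<le> h \<le> 1/2 |B u|\<^sup>2 \<le> 2 \<kappa> / l\<close>, hence
  \<open>Var h \<le> 2 \<kappa> / l \<cdot> N\<^sub>2\<^sup>2\<close>, and Bernstein's inequality combined with Hoeffding's averaging over
  orderings of the sample (\<open>s div 2 \<ge> s / 3\<close> independent terms) yields the first bound. If the
  eigenfunctions are bounded by \<open>C\<close>, expanding \<open>u\<close> in the orthonormal system
  \<open>lam\<^sub>i\<^bsup>1/2\<^esup> \<phi>\<^sub>i\<close> gives \<open>|B u|\<^sup>2 \<le> 4 C\<^sup>2 N\<^sub>1\<close> almost surely, and the same argument applies.\<close>

section \<open>Hilbert spaces\<close>

text \<open>Two obstacles shape the proof. First, a vector of the RKHS orthogonal to all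
  eigenfunctions is known to be constant only on the support of \<open>P\<close>, so the
  eigenfunction bound on \<open>h\<close> holds almost surely. The concentration part therefore
  carries a pointwise bound, for integrability, beside an almost sure bound \<open>b\<close>, which
  alone enters the constants; both claims are then one statement, with \<open>b\<close> equal to
  \<open>2 * \<kappa> / l\<close> or to \<open>2 * C\<^sup>2 * N1 evf P l\<close>. Second, square
  root, inverse and adjoint are definite descriptions, so existence and uniqueness have to be proved
  before they can be used, while trace and Hilbert-Schmidt product refer to one arbitrarily chosen
  basis. Rewriting \<open>N1\<close> and \<open>N2\<close> as integrals over pairs of observations
  removes that basis and replaces spectral calculus. In the final bounds,
  \<open>ln (2 / \<delta>)\<close> comes from the two tails, and the 12 is the 2 in front of the
  variance term of Bernstein's inequality, times the 3 of \<open>s / 3\<close>, times the 2 in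
  \<open>b\<close>.\<close>

lemma closed_subspace_projection:
  fixes V :: "'h::{real_inner,complete_space} set"
  assumes V: "subspace V" "closed V"
  obtains p where "p \<in> V" "\<And>v. v \<in> V \<Longrightarrow> (x - p) \<bullet> v = 0"
proof -
  define D where "D = (INF v\<in>V. (norm (x - v))\<^sup>2)"
  have ne: "V \<noteq> {}" using V(1) subspace_0 by blast
  have bdd: "bdd_below ((\<lambda>v. (norm (x - v))\<^sup>2) ` V)"
    by (rule bdd_belowI[of _ 0]) auto
  have D_le: "D \<le> (norm (x - v))\<^sup>2" if "v \<in> V" for v
    unfolding D_def by (rule cINF_lower[OF bdd that])
  have "\<exists>v\<in>V. (norm (x - v))\<^sup>2 < D + 1 / (real n + 1)" for n
  proof -
    have "(INF v\<in>V. (norm (x - v))\<^sup>2) < D + 1 / (real n + 1)" by (simp add: D_def)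
    then show ?thesis using cINF_less_iff[OF ne bdd] by blast
  qed
  then obtain v where v: "\<And>n. v n \<in> V" "\<And>n. (norm (x - v n))\<^sup>2 < D + 1 / (real n + 1)"
    by metis
  have diff: "(norm (v n - v m))\<^sup>2 \<le> 2 / (real n + 1) + 2 / (real m + 1)" for n m
  proof -
    \<comment> \<open>Parallelogram law: the midpoint stays in \<open>V\<close>, so its squared
      distance to \<open>x\<close> is at least \<open>D\<close>, which forces nearly optimal points
      close together.\<close>
    have mid: "(1/2) *\<^sub>R (v n + v m) \<in> V"
      using v V(1) by (simp add: subspace_add subspace_scale)
    have "(norm (v n - v m))\<^sup>2 = 2 * (norm (x - v n))\<^sup>2 + 2 * (norm (x - v m))\<^sup>2
        - 4 * (norm (x - (1/2) *\<^sub>R (v n + v m)))\<^sup>2"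
      by (simp add: power2_norm_eq_inner inner_simps inner_commute algebra_simps)
    also have "\<dots> \<le> 2 / (real n + 1) + 2 / (real m + 1)"
      using D_le[OF mid] v(2)[of n] v(2)[of m] by simp
    finally show ?thesis .
  qed
  have "Cauchy v"
  proof (rule CauchyI)
    fix e :: real assume e: "0 < e"
    obtain N where N: "4 / (real N + 1) < e\<^sup>2"
    proof -
      obtain N where "4 / e\<^sup>2 < real N" using reals_Archimedean2 by blast
      then have "4 < real N * e\<^sup>2" using e by (simp add: field_simps)
      also have "\<dots> \<le> (real N + 1) * e\<^sup>2" by (simp add: algebra_simps)
      finally have "4 / (real N + 1) < e\<^sup>2" by (simp add: field_simps)
      then show ?thesis by (rule that)
    qed
    have "norm (v m - v n) < e" if "N \<le> m" "N \<le> n" for m n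
    proof -
      have "2 / (real m + 1) \<le> 2 / (real N + 1)" "2 / (real n + 1) \<le> 2 / (real N + 1)"
        using that by (auto intro!: divide_left_mono)
      then have "(norm (v m - v n))\<^sup>2 < e\<^sup>2" using diff[of m n] N by simp
      then show ?thesis by (rule power2_less_imp_less) (use e in simp)
    qed
    then show "\<exists>M. \<forall>m\<ge>M. \<forall>n\<ge>M. norm (v m - v n) < e" by blast
  qed
  then obtain p where p: "v \<longlonglongrightarrow> p" using Cauchy_convergent convergent_def by blast
  have pV: "p \<in> V" using closed_sequentially[OF V(2) v(1) p] by blast
  have "(\<lambda>n. D + 1 / (real n + 1)) \<longlonglongrightarrow> D + 0"
    using LIMSEQ_inverse_real_of_nat by (intro tendsto_intros) (simp add: inverse_eq_divide add.commute)
  moreover have "(\<lambda>n. (norm (x - v n))\<^sup>2) \<longlonglongrightarrow> (norm (x - p))\<^sup>2"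
    by (intro tendsto_intros p)
  ultimately have pD: "(norm (x - p))\<^sup>2 \<le> D"
    using LIMSEQ_le[of "\<lambda>n. (norm (x - v n))\<^sup>2" _ "\<lambda>n. D + 1 / (real n + 1)"]
      less_imp_le[OF v(2)] by auto
  have "(x - p) \<bullet> w = 0" if w: "w \<in> V" for w
  proof (cases "w = 0")
    case False
    \<comment> \<open>The coefficient of the projection of \<open>x - p\<close> onto
      \<open>w\<close>: moving \<open>p\<close> by \<open>t *\<^sub>R w\<close> would lower the
      squared distance unless the inner product vanishes.\<close>
    define t where "t = ((x - p) \<bullet> w) / (w \<bullet> w)"
    have "p + t *\<^sub>R w \<in> V" using pV w V(1) by (simp add: subspace_add subspace_scale)
    then have "(norm (x - p))\<^sup>2 \<le> (norm (x - (p + t *\<^sub>R w)))\<^sup>2" using D_le pD order_trans by blast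
    also have "\<dots> = (norm (x - p))\<^sup>2 - 2 * t * ((x - p) \<bullet> w) + t * t * (w \<bullet> w)"
      by (simp add: power2_norm_eq_inner inner_simps inner_commute algebra_simps)
    also have "\<dots> = (norm (x - p))\<^sup>2 - ((x - p) \<bullet> w)\<^sup>2 / (w \<bullet> w)"
      using False by (simp add: t_def power2_eq_square field_simps)
    finally have "((x - p) \<bullet> w)\<^sup>2 / (w \<bullet> w) \<le> 0" by simp
    moreover have "w \<bullet> w > 0" using False by simp
    ultimately have "((x - p) \<bullet> w)\<^sup>2 \<le> 0" by (simp add: divide_le_0_iff)
    then show ?thesis by simp
  qed simp
  then show ?thesis using pV that by blast
qed

text \<open>The kernel has codimension one. A vector \<open>q\<close> orthogonal to it and outside
  it determines the functional, because subtracting a suitable multiple of \<open>q\<close> moves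
  any \<open>f\<close> into the kernel.\<close>

lemma Riesz_representation:
  fixes \<phi> :: "'h::{real_inner,complete_space} \<Rightarrow> real"
  assumes "bounded_linear \<phi>"
  obtains h where "\<And>f. \<phi> f = f \<bullet> h"
proof (cases "\<forall>f. \<phi> f = 0")
  case True
  then show ?thesis using that[of 0] by simp
next
  case False
  interpret bounded_linear \<phi> by fact
  obtain x where x: "\<phi> x \<noteq> 0" using False by blast
  have "subspace {f. \<phi> f = 0}"
    by (auto simp: subspace_def add scaleR zero)
  moreover have "closed {f. \<phi> f = 0}"
    by (intro closed_Collect_eq continuous_on continuous_on_id continuous_on_const)
  ultimately obtain p where p: "p \<in> {f. \<phi> f = 0}" "\<And>v. v \<in> {f. \<phi> f = 0} \<Longrightarrow> (x - p) \<bullet> v = 0"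
    using closed_subspace_projection[where x = x] by metis
  define q where "q = x - p"
  have q: "\<phi> q \<noteq> 0" using x p by (simp add: q_def diff)
  then have "q \<bullet> q \<noteq> 0" by (auto simp: zero)
  have "\<phi> f = f \<bullet> ((\<phi> q / (q \<bullet> q)) *\<^sub>R q)" for f
  proof -
    have "\<phi> (f - (\<phi> f / \<phi> q) *\<^sub>R q) = 0" using q by (simp add: diff scaleR)
    then have "q \<bullet> (f - (\<phi> f / \<phi> q) *\<^sub>R q) = 0" using p(2) unfolding q_def by blast
    then show ?thesis using q \<open>q \<bullet> q \<noteq> 0\<close>
      by (simp add: inner_simps inner_commute field_simps)
  qed
  then show ?thesis by (rule that)
qed

section \<open>Orthonormal systems, expansions and bases\<close>

lemma subspace_closure_span: "subspace (closure (span E :: 'h::real_normed_vector set))"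
proof (rule subspaceI)
  show "0 \<in> closure (span E)" using closure_subset span_zero by blast
  fix x y assume "x \<in> closure (span E)" "y \<in> closure (span E)"
  then obtain a b where "\<And>n::nat. a n \<in> span E" "a \<longlonglongrightarrow> x" "\<And>n::nat. b n \<in> span E" "b \<longlonglongrightarrow> y"
    by (auto simp: closure_sequential)
  then show "x + y \<in> closure (span E)" unfolding closure_sequential
    by (intro exI[of _ "\<lambda>n. a n + b n"]) (auto intro: span_add tendsto_add)
next
  fix c x assume "x \<in> closure (span E)"
  then obtain a where "\<And>n::nat. a n \<in> span E" "a \<longlonglongrightarrow> x"
    by (auto simp: closure_sequential)
  then show "c *\<^sub>R x \<in> closure (span E)" unfolding closure_sequential
    by (intro exI[of _ "\<lambda>n. c *\<^sub>R a n"]) (auto intro: span_scale tendsto_scaleR)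
qed

text \<open>\<open>orthonormal_basis\<close> without density: the normalised eigenfunctions form
  such a system but need not span a dense subspace.\<close>

definition orthonormal :: "'h::real_inner set \<Rightarrow> bool" where
  "orthonormal E \<longleftrightarrow> (\<forall>e\<in>E. norm e = 1) \<and> pairwise orthogonal E"

lemma orthonormal_subset: "orthonormal E \<Longrightarrow> F \<subseteq> E \<Longrightarrow> orthonormal F"
  unfolding orthonormal_def using pairwise_subset by blast

lemma orthonormal_inner:
  "orthonormal E \<Longrightarrow> e \<in> E \<Longrightarrow> d \<in> E \<Longrightarrow> e \<bullet> d = (if e = d then 1 else 0)"
  by (auto simp: orthonormal_def pairwise_def orthogonal_def norm_eq_1)

lemma orthonormal_inner_sum:
  assumes "orthonormal E" "finite F" "F \<subseteq> E" "d \<in> F"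
  shows "(\<Sum>e\<in>F. c e *\<^sub>R e) \<bullet> d = c d"
proof -
  have "(\<Sum>e\<in>F. c e *\<^sub>R e) \<bullet> d = (\<Sum>e\<in>F. if e = d then c e else 0)"
    unfolding inner_sum_left using assms orthonormal_inner[OF assms(1)]
    by (intro sum.cong) (auto simp: subset_eq)
  then show ?thesis using assms by simp
qed

lemma norm_diff_partial_expansion:
  fixes x :: "'h::real_inner"
  assumes "orthonormal E" "finite F" "F \<subseteq> E"
  shows "(norm (x - (\<Sum>e\<in>F. (x \<bullet> e) *\<^sub>R e)))\<^sup>2 = (norm x)\<^sup>2 - (\<Sum>e\<in>F. (x \<bullet> e)\<^sup>2)"
proof -
  let ?s = "\<Sum>e\<in>F. (x \<bullet> e) *\<^sub>R e"
  have "?s \<bullet> ?s = (\<Sum>d\<in>F. (x \<bullet> d) * (?s \<bullet> d))" by (subst inner_sum_right) simp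
  also have "\<dots> = (\<Sum>d\<in>F. (x \<bullet> d)\<^sup>2)"
    by (intro sum.cong) (auto simp: orthonormal_inner_sum[OF assms] power2_eq_square)
  finally have 1: "?s \<bullet> ?s = (\<Sum>d\<in>F. (x \<bullet> d)\<^sup>2)" .
  have 2: "x \<bullet> ?s = (\<Sum>d\<in>F. (x \<bullet> d)\<^sup>2)" by (simp add: inner_sum_right power2_eq_square)
  show ?thesis unfolding power2_norm_eq_inner using 1 2
    by (simp add: inner_diff_left inner_diff_right inner_commute)
qed

lemma Bessel_inequality:
  fixes x :: "'h::real_inner"
  assumes "orthonormal E" "finite F" "F \<subseteq> E"
  shows "(\<Sum>e\<in>F. (x \<bullet> e)\<^sup>2) \<le> (norm x)\<^sup>2"
  using norm_diff_partial_expansion[OF assms, of x] by (metis diff_ge_0_iff_ge zero_le_power2)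

text \<open>The partial expansion over \<open>G\<close> is the best approximation from the span of
  \<open>G\<close>, so it beats any given approximant once \<open>G\<close> contains the vectors
  used by that approximant. Only membership in the closed span is required, which is what the
  eigenfunctions can offer for \<open>u z\<close>.\<close>

lemma orthonormal_expansion:
  fixes x :: "'h::real_inner"
  assumes E: "orthonormal E" and x: "x \<in> closure (span E)"
  shows "((\<lambda>e. (x \<bullet> e) *\<^sub>R e) has_sum x) E"
  unfolding has_sum_def tendsto_iff eventually_finite_subsets_at_top
proof (intro allI impI)
  fix \<epsilon> :: real assume "\<epsilon> > 0"
  then obtain y where y: "y \<in> span E" "dist y x < \<epsilon>" using x closure_approachable by blast
  from y(1) obtain F r where F: "finite F" "F \<subseteq> E" "y = (\<Sum>a\<in>F. r a *\<^sub>R a)"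
    by (auto simp: span_explicit)
  have "dist (\<Sum>e\<in>G. (x \<bullet> e) *\<^sub>R e) x < \<epsilon>" if G: "finite G" "F \<subseteq> G" "G \<subseteq> E" for G
  proof -
    let ?s = "\<Sum>e\<in>G. (x \<bullet> e) *\<^sub>R e"
    define z where "z = ?s - y"
    have orth: "(x - ?s) \<bullet> d = 0" if "d \<in> G" for d
      using orthonormal_inner_sum[OF E G(1,3) that, of "\<lambda>e. x \<bullet> e"] by (simp add: inner_diff_left)
    have "(x - ?s) \<bullet> ?s = 0" by (subst inner_sum_right) (simp add: orth)
    moreover have "(x - ?s) \<bullet> y = 0"
      unfolding F(3) inner_sum_right using orth G(2) by (simp add: subset_eq)
    ultimately have "(x - ?s) \<bullet> z = 0" by (simp add: z_def inner_diff_right)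
    moreover have "x - y = (x - ?s) + z" by (simp add: z_def)
    ultimately have "(norm (x - y))\<^sup>2 = (norm (x - ?s))\<^sup>2 + (norm z)\<^sup>2"
      by (metis norm_add_Pythagorean orthogonal_def)
    then have "norm (x - ?s) \<le> norm (x - y)"
      by (metis le_add_same_cancel1 norm_ge_zero power2_le_imp_le zero_le_power2)
    then show ?thesis using y(2) by (simp add: dist_norm norm_minus_commute)
  qed
  then show "\<exists>X. finite X \<and> X \<subseteq> E \<and> (\<forall>Y. finite Y \<and> X \<subseteq> Y \<and> Y \<subseteq> E \<longrightarrow>
      dist (\<Sum>e\<in>Y. (x \<bullet> e) *\<^sub>R e) x < \<epsilon>)" using F by blast
qed

lemma orthonormal_basis_iff:
  "orthonormal_basis E \<longleftrightarrow> orthonormal E \<and> closure (span E) = UNIV"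
  by (auto simp: orthonormal_basis_def orthonormal_def)

lemma Parseval:
  fixes x y :: "'h::real_inner"
  assumes "orthonormal_basis E"
  shows "((\<lambda>e. (x \<bullet> e) * (y \<bullet> e)) has_sum x \<bullet> y) E"
proof -
  have "((\<lambda>e. (x \<bullet> e) *\<^sub>R e) has_sum x) E"
    using assms by (intro orthonormal_expansion) (auto simp: orthonormal_basis_iff)
  from has_sum_bounded_linear[OF bounded_linear_inner_left[of y] this]
  show ?thesis by (simp add: inner_commute)
qed

text \<open>Gives meaning to the choice of basis in \<open>trace_op\<close> and
  \<open>hs_inner\<close>. A maximal orthonormal set is dense: otherwise the normalised residual of
  a projection could be added to it.\<close>

lemma orthonormal_basis_exists:
  "\<exists>E :: 'h::{real_inner,complete_space} set. orthonormal_basis E"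
proof -
  have "\<exists>M\<in>{E::'h set. orthonormal E}. \<forall>X\<in>{E. orthonormal E}. M \<subseteq> X \<longrightarrow> X = M"
  proof (rule subset_Zorn)
    fix C :: "'h set set" assume C: "subset.chain {E. orthonormal E} C"
    have "orthogonal a b" if "X \<in> C" "Y \<in> C" "a \<in> X" "b \<in> Y" "a \<noteq> b" for X Y a b
    proof -
      have "X \<subseteq> Y \<or> Y \<subseteq> X" using C that by (auto simp: subset_chain_def)
      moreover have "orthonormal X" "orthonormal Y" using C that by (auto simp: subset_chain_def)
      ultimately show ?thesis using that unfolding orthonormal_def pairwise_def by blast
    qed
    moreover have "norm a = 1" if "X \<in> C" "a \<in> X" for X a
      using C that by (auto simp: subset_chain_def orthonormal_def)
    ultimately have "orthonormal (\<Union>C)" unfolding orthonormal_def pairwise_def by blast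
    then show "\<exists>U\<in>{E. orthonormal E}. \<forall>X\<in>C. X \<subseteq> U" by blast
  qed
  then obtain M :: "'h set" where M: "orthonormal M" "\<And>X. orthonormal X \<Longrightarrow> M \<subseteq> X \<Longrightarrow> X = M"
    by blast
  have "x \<in> closure (span M)" for x
  proof (rule ccontr)
    assume x: "x \<notin> closure (span M)"
    obtain p where p: "p \<in> closure (span M)" "\<And>v. v \<in> closure (span M) \<Longrightarrow> (x - p) \<bullet> v = 0"
      using closed_subspace_projection[OF subspace_closure_span closed_closure] by blast
    define q where "q = (x - p) /\<^sub>R norm (x - p)"
    have "x - p \<noteq> 0" using x p by auto
    then have q: "norm q = 1" by (simp add: q_def)
    have orth: "q \<bullet> v = 0" if "v \<in> M" for v
    proof -
      have "v \<in> closure (span M)" using that closure_subset span_base by blast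
      then show ?thesis using p(2)[of v] by (simp add: q_def)
    qed
    have "orthonormal (insert q M)"
      using M(1) q orth by (auto simp: orthonormal_def pairwise_insert orthogonal_def inner_commute)
    then have "q \<in> M" using M(2)[of "insert q M"] by blast
    then have "q \<bullet> q = 0" by (rule orth)
    then show False using q by simp
  qed
  then show ?thesis using M(1) by (auto simp: orthonormal_basis_iff)
qed

section \<open>Positive square roots\<close>

text \<open>The sort \<open>{real_inner,complete_space}\<close> does not entail the class \<open>banach\<close>, so the library
  instance for completeness of the space of bounded operators does not apply.\<close>

lemma Cauchy_blinfun_convergent:
  fixes X :: "nat \<Rightarrow> 'h::real_normed_vector \<Rightarrow>\<^sub>L 'k::{real_normed_vector,complete_space}"
  assumes X: "Cauchy X"
  obtains L where "X \<longlonglongrightarrow> L"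
proof -
  have unif: "\<exists>M. \<forall>m\<ge>M. \<forall>n\<ge>M. \<forall>f. norm (X m f - X n f) \<le> e * norm f" if e: "e > 0" for e
  proof -
    obtain M where M: "\<And>m n. m \<ge> M \<Longrightarrow> n \<ge> M \<Longrightarrow> norm (X m - X n) < e"
      using CauchyD[OF X e] by auto
    have "norm (X m f - X n f) \<le> e * norm f" if "m \<ge> M" "n \<ge> M" for m n f
      using norm_blinfun[of "X m - X n" f] M[OF that] mult_right_mono[OF less_imp_le[OF M[OF that]], of "norm f"]
      by (simp add: blinfun.diff_left)
    then show ?thesis by blast
  qed
  have "Cauchy (\<lambda>n. X n f)" for f
  proof (rule CauchyI)
    fix e :: real assume e: "e > 0"
    then have "e / (norm f + 1) > 0" by (simp add: add_nonneg_pos)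
    then obtain M where M: "\<And>m n. m \<ge> M \<Longrightarrow> n \<ge> M \<Longrightarrow> norm (X m f - X n f) \<le> e / (norm f + 1) * norm f"
      using unif by blast
    have "e * norm f < e * (norm f + 1)" using e by (simp add: algebra_simps)
    then have "e / (norm f + 1) * norm f < e" by (simp add: divide_less_eq add_nonneg_pos)
    then show "\<exists>M. \<forall>m\<ge>M. \<forall>n\<ge>M. norm (X m f - X n f) < e" using M le_less_trans by blast
  qed
  then have "\<forall>f. \<exists>l. (\<lambda>n. X n f) \<longlonglongrightarrow> l" using Cauchy_convergent convergent_def by blast
  then obtain v where v: "\<And>f. (\<lambda>n. X n f) \<longlonglongrightarrow> v f" by metis
  have lim: "\<exists>M. \<forall>n\<ge>M. \<forall>f. norm (X n f - v f) \<le> e * norm f" if e: "e > 0" for e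
  proof -
    obtain M where M: "\<And>m n f. m \<ge> M \<Longrightarrow> n \<ge> M \<Longrightarrow> norm (X m f - X n f) \<le> e * norm f"
      using unif[OF e] by blast
    have "norm (X n f - v f) \<le> e * norm f" if "n \<ge> M" for n f
    proof (rule LIMSEQ_le_const2)
      show "(\<lambda>m. norm (X n f - X m f)) \<longlonglongrightarrow> norm (X n f - v f)" by (intro tendsto_intros v)
      show "\<exists>N. \<forall>m\<ge>N. norm (X n f - X m f) \<le> e * norm f" using M that by blast
    qed
    then show ?thesis by blast
  qed
  have lin: "linear v"
  proof (rule linearI)
    fix a b show "v (a + b) = v a + v b"
      by (rule LIMSEQ_unique[OF v]) (simp add: blinfun.add_right tendsto_add v)
    fix r show "v (r *\<^sub>R a) = r *\<^sub>R v a"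
      by (rule LIMSEQ_unique[OF v]) (simp add: blinfun.scaleR_right tendsto_scaleR v)
  qed
  obtain M where M: "\<And>f. norm (X M f - v f) \<le> 1 * norm f" using lim[of 1] by auto
  have "bounded_linear v"
  proof (rule bounded_linear_intro)
    fix a b r show "v (a + b) = v a + v b" "v (r *\<^sub>R a) = r *\<^sub>R v a"
      using lin by (auto simp: linear_add linear_scale)
    have "norm (v a) \<le> norm (X M a) + norm (X M a - v a)"
      by (metis norm_triangle_sub norm_minus_commute add.commute)
    also have "\<dots> \<le> norm a * (norm (X M) + 1)"
      using norm_blinfun[of "X M" a] M[of a] by (simp add: algebra_simps)
    finally show "norm (v a) \<le> norm a * (norm (X M) + 1)" .
  qed
  then have L: "blinfun_apply (Blinfun v) = v" by (rule bounded_linear_Blinfun_apply)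
  have "X \<longlonglongrightarrow> Blinfun v"
  proof (rule LIMSEQ_I)
    fix e :: real assume e: "e > 0"
    obtain M where M: "\<And>n f. n \<ge> M \<Longrightarrow> norm (X n f - v f) \<le> (e/2) * norm f"
      using lim[of "e/2"] e by auto
    have "norm (X n - Blinfun v) \<le> e/2" if "n \<ge> M" for n
      using e M[OF that] by (intro norm_blinfun_bound) (auto simp: blinfun.diff_left L)
    then show "\<exists>no. \<forall>n\<ge>no. norm (X n - Blinfun v) < e" using e by (intro exI[of _ M]) force
  qed
  then show ?thesis by (rule that)
qed

lemma complete_blinfun: "Topological_Spaces.complete (UNIV :: ('h::{real_inner,complete_space} \<Rightarrow>\<^sub>L 'h) set)"
  unfolding metric_space_class.complete_def using Cauchy_blinfun_convergent by (metis UNIV_I)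

text \<open>The Neumann series in disguise: \<open>Y = 1 + X Y\<close> is a contraction.\<close>

lemma inverse_id_minus_contraction:
  fixes X :: "'h::{real_inner,complete_space} \<Rightarrow>\<^sub>L 'h"
  assumes "norm X < 1"
  obtains Y where "(id_blinfun - X) o\<^sub>L Y = id_blinfun" "Y o\<^sub>L (id_blinfun - X) = id_blinfun"
proof -
  have "\<exists>!Y\<in>UNIV. id_blinfun + (X o\<^sub>L Y) = Y"
  proof (rule Banach_fix[where c = "norm X"], goal_cases)
    case (6 Y Z)
    have "dist (id_blinfun + (X o\<^sub>L Y)) (id_blinfun + (X o\<^sub>L Z)) = norm (X o\<^sub>L (Y - Z))"
      by (simp add: dist_norm bounded_bilinear.diff_right[OF bounded_bilinear_blinfun_compose])
    then show ?case
      by (simp add: dist_norm norm_blinfun_compose)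
  qed (use complete_blinfun assms in auto)
  then obtain Y where Y: "id_blinfun + (X o\<^sub>L Y) = Y" by blast
  \<comment> \<open>The first fixed point is a right inverse of \<open>id_blinfun - X\<close>, this
    one a left inverse; having both makes them equal.\<close>
  have "\<exists>!Y\<in>UNIV. id_blinfun + (Y o\<^sub>L X) = Y"
  proof (rule Banach_fix[where c = "norm X"], goal_cases)
    case (6 Y Z)
    have "dist (id_blinfun + (Y o\<^sub>L X)) (id_blinfun + (Z o\<^sub>L X)) = norm ((Y - Z) o\<^sub>L X)"
      by (simp add: dist_norm bounded_bilinear.diff_left[OF bounded_bilinear_blinfun_compose])
    then show ?case
      by (metis dist_norm norm_blinfun_compose mult.commute)
  qed (use complete_blinfun assms in auto)
  then obtain Z where Z: "id_blinfun + (Z o\<^sub>L X) = Z" by blast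
  have Y': "Y f - X (Y f) = f" for f
    using arg_cong[OF Y, of "\<lambda>W. blinfun_apply W f"] by (simp add: blinfun.add_left algebra_simps)
  have Z': "Z f - Z (X f) = f" for f
    using arg_cong[OF Z, of "\<lambda>W. blinfun_apply W f"] by (simp add: blinfun.add_left algebra_simps)
  have "Z f = Y f" for f
    using Z'[of "Y f"] Y'[of f] by (metis blinfun.diff_right)
  then have "Y (f - X f) = f" for f using Z' by (metis blinfun.diff_right)
  then show ?thesis using Y'
    by (intro that[of Y] blinfun_eqI) (auto simp: blinfun.diff_left)
qed

section \<open>Square roots of coercive operators\<close>

definition self_adj :: "('h::real_inner \<Rightarrow>\<^sub>L 'h) \<Rightarrow> bool" where
  "self_adj A \<longleftrightarrow> (\<forall>f g. A f \<bullet> g = f \<bullet> A g)"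

lemma closed_self_adj: "closed {A :: 'h::real_inner \<Rightarrow>\<^sub>L 'h. self_adj A}"
  unfolding self_adj_def
  by (intro closed_Collect_all closed_Collect_eq continuous_intros)

lemma closed_commuting: "closed {X :: 'h::real_inner \<Rightarrow>\<^sub>L 'h. R o\<^sub>L X = X o\<^sub>L R}"
  by (intro closed_Collect_eq
        bounded_bilinear.continuous_on[OF bounded_bilinear_blinfun_compose] continuous_intros)

text \<open>\<open>1 - X\<close> is a square root of \<open>1 - T\<close> iff \<open>X = (T + X\<^sup>2) / 2\<close>, a contraction on the
  ball of radius \<open>norm T\<close>.\<close>

lemma sqrt_id_minus_contraction:
  fixes T :: "'h::{real_inner,complete_space} \<Rightarrow>\<^sub>L 'h"
  assumes T: "self_adj T" "norm T < 1"
  obtains X where "norm X \<le> norm T" "self_adj X" "\<And>R. R o\<^sub>L T = T o\<^sub>L R \<Longrightarrow> R o\<^sub>L X = X o\<^sub>L R"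
    "(id_blinfun - X) o\<^sub>L (id_blinfun - X) = id_blinfun - T"
proof -
  \<comment> \<open>Symmetry and commutation with everything that commutes with \<open>T\<close> are
    closed conditions, so the fixed point inherits them from the set on which the contraction acts.
    The commutation is what later makes the positive square root unique.\<close>
  define Q where "Q = cball 0 (norm T) \<inter> {X. self_adj X} \<inter> (\<Inter>R\<in>{R. R o\<^sub>L T = T o\<^sub>L R}. {X. R o\<^sub>L X = X o\<^sub>L R})"
  define \<Phi> where "\<Phi> X = (1/2) *\<^sub>R (T + (X o\<^sub>L X))" for X
  have "closed Q"
    unfolding Q_def by (intro closed_Int closed_INT ballI closed_commuting closed_self_adj closed_cball)
  then have Qc: "Topological_Spaces.complete Q" using complete_blinfun complete_Int_closed by (metis inf_top_left)
  have "0 \<in> Q" by (auto simp: Q_def self_adj_def intro!: blinfun_eqI)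
  have sq: "norm (X o\<^sub>L X) \<le> norm T" if "norm X \<le> norm T" for X :: "'h \<Rightarrow>\<^sub>L 'h"
  proof -
    have "norm (X o\<^sub>L X) \<le> norm X * norm X" by (rule norm_blinfun_compose)
    also have "\<dots> \<le> norm T * 1" using that T(2) by (intro mult_mono) auto
    finally show ?thesis by simp
  qed
  have "\<Phi> X \<in> Q" if "X \<in> Q" for X
  proof -
    have "norm (\<Phi> X) \<le> norm T"
    proof -
      have "norm X \<le> norm T" using that by (simp add: Q_def)
      then have "norm (T + (X o\<^sub>L X)) \<le> norm T + norm T"
        using norm_triangle_ineq[of T "X o\<^sub>L X"] sq[of X] by linarith
      then show ?thesis unfolding \<Phi>_def norm_scaleR by simp
    qed
    moreover have QX: "self_adj X" using that by (simp add: Q_def)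
    have "self_adj (\<Phi> X)"
      using QX T(1) unfolding \<Phi>_def self_adj_def by (simp add: blinfun.add_left blinfun.scaleR_left inner_simps)
    moreover have "R o\<^sub>L \<Phi> X = \<Phi> X o\<^sub>L R" if R: "R o\<^sub>L T = T o\<^sub>L R" for R
    proof -
      have 1: "R (T f) = T (R f)" for f using R by (metis blinfun_apply_blinfun_compose)
      have "R o\<^sub>L X = X o\<^sub>L R" using \<open>X \<in> Q\<close> R by (auto simp: Q_def)
      then have 2: "R (X f) = X (R f)" for f by (metis blinfun_apply_blinfun_compose)
      show ?thesis
        by (rule blinfun_eqI) (simp add: \<Phi>_def blinfun.add_left blinfun.scaleR_left blinfun.add_right blinfun.scaleR_right 1 2)
    qed
    ultimately show ?thesis by (auto simp: Q_def)
  qed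
  moreover have "dist (\<Phi> X) (\<Phi> Y) \<le> norm T * dist X Y" if "X \<in> Q" "Y \<in> Q" for X Y
  proof -
    \<comment> \<open>The difference of squares is split without assuming that \<open>X\<close> and
      \<open>Y\<close> commute.\<close>
    have "\<Phi> X - \<Phi> Y = (1/2) *\<^sub>R ((X o\<^sub>L (X - Y)) + ((X - Y) o\<^sub>L Y))"
      by (rule blinfun_eqI) (simp add: \<Phi>_def blinfun.bilinear_simps algebra_simps)
    then have "norm (\<Phi> X - \<Phi> Y) \<le> (1/2) * (norm (X o\<^sub>L (X - Y)) + norm ((X - Y) o\<^sub>L Y))"
      by (simp add: norm_triangle_ineq)
    also have "\<dots> \<le> (1/2) * (norm X * norm (X - Y) + norm (X - Y) * norm Y)"
      using norm_blinfun_compose[of X "X - Y"] norm_blinfun_compose[of "X - Y" Y] by simp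
    also have "\<dots> \<le> (1/2) * (norm T * norm (X - Y) + norm (X - Y) * norm T)"
      using that by (intro mult_left_mono add_mono mult_mono) (auto simp: Q_def)
    finally show ?thesis by (simp add: dist_norm)
  qed
  ultimately have "\<exists>!X\<in>Q. \<Phi> X = X"
    using \<open>0 \<in> Q\<close> Qc T(2) by (intro Banach_fix[of Q "norm T"]) auto
  then obtain X where X: "X \<in> Q" "\<Phi> X = X" by blast
  have dbl: "X f + X f = T f + X (X f)" for f
  proof -
    have "X f = (1/2) *\<^sub>R (T f + X (X f))"
      using arg_cong[OF X(2), of "\<lambda>W. blinfun_apply W f"]
      by (simp add: \<Phi>_def blinfun.add_left blinfun.scaleR_left)
    then have "2 *\<^sub>R X f = 2 *\<^sub>R ((1/2) *\<^sub>R (T f + X (X f)))" by (rule arg_cong)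
    then show ?thesis by (simp add: scaleR_2)
  qed
  have "f - X f - X (f - X f) = f - T f" for f
    using dbl[of f] by (simp add: blinfun.diff_right algebra_simps)
  then have "(id_blinfun - X) o\<^sub>L (id_blinfun - X) = id_blinfun - T"
    by (intro blinfun_eqI) (simp add: blinfun.diff_left)
  then show ?thesis using X(1) that unfolding Q_def by auto
qed

text \<open>Coercivity allows rescaling: \<open>id_blinfun - \<epsilon> *\<^sub>R A\<close> has norm
  below 1 for a suitable \<epsilon>, and the contraction argument applies. The three conclusions are
  all that is used later about the inverse square root.\<close>

lemma sqrt_op_inverse:
  fixes A :: "'h::{real_inner,complete_space} \<Rightarrow>\<^sub>L 'h"
  assumes A: "pos_op A" and c: "c > 0" "\<And>f. c * (norm f)\<^sup>2 \<le> A f \<bullet> f"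
  defines "B \<equiv> inv_op (sqrt_op A)"
  shows "B f \<bullet> g = f \<bullet> B g" and "B (A (B f)) = f" and "B (B (A f)) = f"
proof -
  \<comment> \<open>Estimating the norm of \<open>T f\<close> gives the factor
    \<open>1 - 2 * \<epsilon> * c + \<epsilon>\<^sup>2 * N\<close>, smallest at
    \<open>\<epsilon> = c / N\<close>. Adding \<open>c\<^sup>2\<close> keeps \<open>N\<close>
    positive even on the zero space and makes \<open>1 - c\<^sup>2 / N\<close> a legitimate
    square.\<close>
  define N where "N = (norm A)\<^sup>2 + c\<^sup>2"
  define \<epsilon> where "\<epsilon> = c / N"
  define T where "T = id_blinfun - \<epsilon> *\<^sub>R A"
  define t where "t = sqrt (1 - c\<^sup>2 / N)"
  have N: "N > 0" using c by (simp add: N_def add_nonneg_pos)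
  have \<epsilon>: "\<epsilon> > 0" using N c by (simp add: \<epsilon>_def)
  have cN: "c\<^sup>2 / N \<le> 1" "c\<^sup>2 / N > 0" using N c by (simp_all add: N_def)
  then have t: "0 \<le> t" "t < 1" by (auto simp: t_def)
  have "norm (T f) \<le> t * norm f" for f
  proof -
    have "(norm (A f))\<^sup>2 \<le> (norm A)\<^sup>2 * (norm f)\<^sup>2"
      using norm_blinfun[of A f] by (metis norm_ge_zero power_mono power_mult_distrib)
    also have "\<dots> \<le> N * (norm f)\<^sup>2" by (simp add: N_def mult_right_mono)
    finally have Af: "(norm (A f))\<^sup>2 \<le> N * (norm f)\<^sup>2" .
    have "(norm (T f))\<^sup>2 = (norm f)\<^sup>2 - 2 * \<epsilon> * (A f \<bullet> f) + \<epsilon>\<^sup>2 * (norm (A f))\<^sup>2"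
      unfolding power2_norm_eq_inner
      by (simp add: T_def blinfun.diff_left blinfun.scaleR_left inner_simps
            inner_commute algebra_simps power2_eq_square[of \<epsilon>])
    also have "\<dots> \<le> (norm f)\<^sup>2 - 2 * \<epsilon> * (c * (norm f)\<^sup>2) + \<epsilon>\<^sup>2 * (N * (norm f)\<^sup>2)"
      using \<epsilon> c(2)[of f] Af by (intro add_mono diff_mono mult_left_mono) auto
    also have "\<dots> = (1 - c\<^sup>2 / N) * (norm f)\<^sup>2"
      using N by (simp add: \<epsilon>_def power2_eq_square field_simps)
    also have "\<dots> = (t * norm f)\<^sup>2" using cN by (simp add: t_def power_mult_distrib)
    finally show ?thesis by (rule power2_le_imp_le) (simp add: t)
  qed
  then have "norm T \<le> t" using t by (intro norm_blinfun_bound) auto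
  then have T1: "norm T < 1" using t by simp
  have "self_adj T" using A
    by (auto simp: self_adj_def T_def pos_op_def blinfun.diff_left blinfun.scaleR_left inner_simps)
  then obtain X where X: "norm X \<le> norm T" "self_adj X"
    "\<And>R. R o\<^sub>L T = T o\<^sub>L R \<Longrightarrow> R o\<^sub>L X = X o\<^sub>L R"
    "(id_blinfun - X) o\<^sub>L (id_blinfun - X) = id_blinfun - T"
    using sqrt_id_minus_contraction T1 by blast
  \<comment> \<open>Undoes the scaling: the square of \<open>d *\<^sub>R (id_blinfun - X)\<close> is
    \<open>id_blinfun - T\<close> divided by \<epsilon>, that is, \<open>A\<close>.\<close>
  define d where "d = sqrt (1 / \<epsilon>)"
  have d: "d > 0" "d * d * \<epsilon> = 1" using \<epsilon> by (auto simp: d_def)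
  define S where "S = d *\<^sub>R (id_blinfun - X)"
  have S_apply: "S f = d *\<^sub>R (f - X f)" for f
    by (simp add: S_def blinfun.scaleR_left blinfun.diff_left)
  have S_adj: "S f \<bullet> g = f \<bullet> S g" for f g
    using X(2) by (simp add: S_apply self_adj_def inner_simps)
  define r where "r = d * (1 - norm X)"
  have r: "r > 0" using d X(1) T1 by (simp add: r_def)
  have S_pos: "r * (norm f)\<^sup>2 \<le> S f \<bullet> f" for f
  proof -
    have "X f \<bullet> f \<le> norm (X f) * norm f" by (rule norm_cauchy_schwarz)
    also have "\<dots> \<le> norm X * norm f * norm f" using norm_blinfun by (rule mult_right_mono) simp
    finally have "(1 - norm X) * (norm f)\<^sup>2 \<le> (f - X f) \<bullet> f"
      by (simp add: inner_diff_left power2_norm_eq_inner[symmetric] power2_eq_square algebra_simps)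
    then show ?thesis using d by (simp add: S_apply r_def)
  qed
  have SS: "S o\<^sub>L S = A"
  proof -
    have "S o\<^sub>L S = (d * d) *\<^sub>R ((id_blinfun - X) o\<^sub>L (id_blinfun - X))"
      by (rule blinfun_eqI) (simp add: S_def blinfun.bilinear_simps scaleR_diff_right)
    also have "\<dots> = A" unfolding X(4) by (simp add: T_def d)
    finally show ?thesis .
  qed
  have posS: "pos_op S"
    unfolding pos_op_def using S_adj S_pos r by (meson mult_nonneg_nonneg less_imp_le order_trans zero_le_power2)
  \<comment> \<open>A positive root \<open>R\<close> commutes with \<open>A\<close>, hence with
    \<open>S\<close>, so \<open>S + R\<close> annihilates \<open>w = S f - R f\<close>. Pairing with
    \<open>w\<close> and using that \<open>S\<close> is strictly positive gives
    \<open>w = 0\<close>.\<close>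
  have uniq: "R = S" if R: "pos_op R" "R o\<^sub>L R = A" for R
  proof -
    have RA: "R (A f) = A (R f)" for f using R(2) by (metis blinfun_apply_blinfun_compose)
    have "R o\<^sub>L T = T o\<^sub>L R"
      by (rule blinfun_eqI) (simp add: T_def RA blinfun.bilinear_simps)
    then have "R o\<^sub>L X = X o\<^sub>L R" by (rule X(3))
    then have RX: "R (X f) = X (R f)" for f by (metis blinfun_apply_blinfun_compose)
    have RS: "R (S f) = S (R f)" for f by (simp add: S_apply RX blinfun.bilinear_simps)
    have sq: "R (R f) = S (S f)" for f using R(2) SS by (metis blinfun_apply_blinfun_compose)
    have "R f = S f" for f
    proof -
      define w where "w = S f - R f"
      have "S w + R w = 0" by (simp add: w_def blinfun.diff_right RS sq)
      then have "S w \<bullet> w + R w \<bullet> w = 0" by (metis inner_add_left inner_zero_left)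
      moreover have "R w \<bullet> w \<ge> 0" using R(1) unfolding pos_op_def by blast
      ultimately have "r * (norm w)\<^sup>2 \<le> 0" using S_pos[of w] by simp
      then show ?thesis using r by (simp add: mult_le_0_iff w_def)
    qed
    then show ?thesis by (rule blinfun_eqI)
  qed
  have sqrtA: "sqrt_op A = S"
    unfolding sqrt_op_def by (rule the_equality) (use posS SS uniq in blast)+
  obtain Y where Y: "(id_blinfun - X) o\<^sub>L Y = id_blinfun" "Y o\<^sub>L (id_blinfun - X) = id_blinfun"
    using inverse_id_minus_contraction[OF le_less_trans[OF X(1) T1]] .
  define Z where "Z = (1 / d) *\<^sub>R Y"
  have SZ: "S o\<^sub>L Z = id_blinfun" "Z o\<^sub>L S = id_blinfun"
    using Y d by (auto simp: S_def Z_def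
        bounded_bilinear.scaleR_left[OF bounded_bilinear_blinfun_compose]
        bounded_bilinear.scaleR_right[OF bounded_bilinear_blinfun_compose])
  have "W = Z" if "S o\<^sub>L W = id_blinfun" "W o\<^sub>L S = id_blinfun" for W
  proof (rule blinfun_eqI)
    fix f
    have "f = S (Z f)" using arg_cong[OF SZ(1), of "\<lambda>V. blinfun_apply V f"] by simp
    then have "W f = W (S (Z f))" by simp
    also have "\<dots> = Z f" using arg_cong[OF that(2), of "\<lambda>V. blinfun_apply V (Z f)"] by simp
    finally show "W f = Z f" .
  qed
  then have B: "B = Z" unfolding B_def sqrtA inv_op_def by (intro the_equality) (use SZ in blast)+
  have BS: "S (B f) = f" "B (S f) = f" for f
    using SZ unfolding B by (metis blinfun_apply_blinfun_compose id_blinfun.rep_eq)+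
  have SSA: "S (S f) = A f" for f using SS by (metis blinfun_apply_blinfun_compose)
  show "B f \<bullet> g = f \<bullet> B g" using S_adj[of "B f" "B g"] by (simp add: BS)
  show "B (A (B f)) = f" "B (B (A f)) = f" by (simp_all add: SSA[symmetric] BS)
qed

section \<open>Bernstein's inequality for U-statistics of order two\<close>

lemma fact_ge_two_three_power: "2 * 3 ^ n \<le> (fact (n + 2) :: real)"
proof (induction n)
  case (Suc n)
  have "2 * 3 ^ Suc n = 3 * (2 * 3 ^ n :: real)" by simp
  also have "\<dots> \<le> (real n + 3) * fact (n + 2)" using Suc by (intro mult_mono) auto
  also have "\<dots> = fact (Suc n + 2)" by (simp add: algebra_simps)
  finally show ?case .
qed simp

text \<open>From the quadratic term on, the factorials grow at least like \<open>2 * 3 ^ n\<close>,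
  so the series is dominated by a geometric one of ratio \<open>c / 3\<close>. This is where the 3
  in Bernstein's inequality originates.\<close>

lemma exp_le_Bernstein:
  fixes x c :: real
  assumes "\<bar>x\<bar> \<le> c" "c < 3"
  shows "exp x \<le> 1 + x + x\<^sup>2 / (2 * (1 - c / 3))"
proof -
  have c: "0 \<le> c" using assms by simp
  have g: "(\<lambda>n. x\<^sup>2 / 2 * (c / 3) ^ n) sums (x\<^sup>2 / 2 * (1 / (1 - c / 3)))"
    using assms c by (intro sums_mult geometric_sums) auto
  have "summable (\<lambda>n. inverse (fact n) *\<^sub>R x ^ n)" by (rule summable_exp_generic)
  then have s: "summable (\<lambda>n. inverse (fact (n + 2)) *\<^sub>R x ^ (n + 2))"
    using summable_iff_shift[of "\<lambda>n. inverse (fact n) *\<^sub>R x ^ n" 2] by blast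
  have "inverse (fact (n + 2)) *\<^sub>R x ^ (n + 2) \<le> x\<^sup>2 / 2 * (c / 3) ^ n" for n
  proof -
    have "x ^ (n + 2) \<le> x\<^sup>2 * \<bar>x\<bar> ^ n"
      unfolding power_add power_abs[symmetric] mult.commute[of "x ^ n"] by (rule mult_left_mono) auto
    also have "\<dots> \<le> x\<^sup>2 * c ^ n" using assms by (intro mult_left_mono power_mono) auto
    finally have 1: "x ^ (n + 2) \<le> x\<^sup>2 * c ^ n" .
    have 2: "inverse (fact (n + 2)) \<le> (1 / (2 * 3 ^ n) :: real)"
      using le_imp_inverse_le[OF fact_ge_two_three_power[of n]] by (simp add: inverse_eq_divide)
    have "inverse (fact (n + 2)) * x ^ (n + 2) \<le> inverse (fact (n + 2)) * (x\<^sup>2 * c ^ n)"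
      using 1 by (intro mult_left_mono) auto
    also have "\<dots> \<le> 1 / (2 * 3 ^ n) * (x\<^sup>2 * c ^ n)" using 2 c by (intro mult_right_mono) auto
    finally show ?thesis by (simp add: power_divide)
  qed
  then have "(\<Sum>n. inverse (fact (n + 2)) *\<^sub>R x ^ (n + 2)) \<le> (\<Sum>n. x\<^sup>2 / 2 * (c / 3) ^ n)"
    using s sums_summable[OF g] by (rule suminf_le)
  then show ?thesis unfolding exp_first_two_terms[of x] using sums_unique[OF g] by simp
qed

lemma (in prob_space) integrable_exp_bounded:
  assumes [measurable]: "X \<in> borel_measurable M" and "\<And>x. \<bar>X x\<bar> \<le> (D::real)"
  shows "integrable M (\<lambda>x. exp (t * X x))"
proof (rule integrable_const_bound[where B = "exp (\<bar>t\<bar> * D)"])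
  have "t * X x \<le> \<bar>t\<bar> * D" for x
    using order_trans[OF abs_ge_self[of "t * X x"]] mult_left_mono[OF assms(2) abs_ge_zero]
    unfolding abs_mult by blast
  then show "AE x in M. norm (exp (t * X x)) \<le> exp (\<bar>t\<bar> * D)" by simp
qed simp

text \<open>The pointwise bound \<open>D\<close> secures integrability; the estimate itself depends
  on \<open>b\<close>, which may hold almost everywhere only.\<close>

lemma (in prob_space) mgf_le_Bernstein:
  assumes [measurable]: "X \<in> borel_measurable M" and D: "\<And>x. \<bar>X x\<bar> \<le> (D::real)"
    and b: "AE x in M. \<bar>X x\<bar> \<le> b" and mean: "expectation X = 0"
    and var: "expectation (\<lambda>x. (X x)\<^sup>2) \<le> v" and t: "0 \<le> t" "t * b < 3"
  shows "expectation (\<lambda>x. exp (t * X x)) \<le> exp (t\<^sup>2 * v / (2 * (1 - t * b / 3)))"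
proof -
  have iX: "integrable M X"
    using D by (intro integrable_const_bound[where B = D]) auto
  have iX2: "integrable M (\<lambda>x. (X x)\<^sup>2)"
    using D by (intro integrable_const_bound[where B = "D\<^sup>2"]) (auto simp: abs_le_square_iff[symmetric] intro: abs_le_square_iff[THEN iffD1] order_trans[OF _ abs_ge_self])
  have q: "1 - t * b / 3 > 0" using t by simp
  have "expectation (\<lambda>x. exp (t * X x)) \<le>
      expectation (\<lambda>x. 1 + t * X x + (t\<^sup>2 / (2 * (1 - t * b / 3))) * (X x)\<^sup>2)"
  proof (rule integral_mono_AE)
    show "integrable M (\<lambda>x. exp (t * X x))" by (rule integrable_exp_bounded) (use D in auto)
    show "integrable M (\<lambda>x. 1 + t * X x + (t\<^sup>2 / (2 * (1 - t * b / 3))) * (X x)\<^sup>2)"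
      using iX iX2 by (intro Bochner_Integration.integrable_add integrable_mult_right) auto
    show "AE x in M. exp (t * X x) \<le> 1 + t * X x + (t\<^sup>2 / (2 * (1 - t * b / 3))) * (X x)\<^sup>2"
      using b
    proof eventually_elim
      case (elim x)
      then have "\<bar>t * X x\<bar> \<le> t * b" using t by (simp add: abs_mult mult_left_mono)
      from exp_le_Bernstein[OF this t(2)] show ?case by (simp add: power_mult_distrib)
    qed
  qed
  also have "\<dots> = 1 + t * expectation X + (t\<^sup>2 / (2 * (1 - t * b / 3))) * expectation (\<lambda>x. (X x)\<^sup>2)"
    using iX iX2 prob_space by simp
  also have "\<dots> \<le> 1 + t\<^sup>2 / (2 * (1 - t * b / 3)) * v"
  proof -
    have "0 \<le> t\<^sup>2 / (2 * (1 - t * b / 3))" using q by (intro divide_nonneg_pos zero_le_power2 mult_pos_pos) auto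
    from mult_left_mono[OF var this] show ?thesis unfolding mean by simp
  qed
  also have "\<dots> \<le> exp (t\<^sup>2 / (2 * (1 - t * b / 3)) * v)" by (rule exp_ge_add_one_self)
  finally show ?thesis by simp
qed

text \<open>Permutations act transitively on ordered pairs of distinct indices, so the inner sum is
  the same for every pair. Summing it over all pairs and exchanging the sums gives the
  identity.\<close>

lemma sum_permutations_pair:
  fixes G :: "'a \<Rightarrow> 'a \<Rightarrow> real"
  assumes S: "finite S" and ab: "a \<in> S" "b \<in> S" "a \<noteq> b"
  shows "real (card S) * (real (card S) - 1) * (\<Sum>p | p permutes S. G (p a) (p b)) =
    real (card {p. p permutes S}) * (\<Sum>i\<in>S. \<Sum>j\<in>S - {i}. G i j)"
proof -
  let ?P = "{p. p permutes S}"
  have same: "(\<Sum>p\<in>?P. G (p c) (p d)) = (\<Sum>p\<in>?P. G (p a) (p b))"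
    if cd: "c \<in> S" "d \<in> S" "c \<noteq> d" for c d
  proof -
    \<comment> \<open>Send \<open>a\<close> to \<open>c\<close> first, then the image of
      \<open>b\<close> to \<open>d\<close>. The second transposition fixes \<open>c\<close>, which
      differs from \<open>d\<close> and from the image of \<open>b\<close>.\<close>
    define q where "q = Transposition.transpose (Transposition.transpose a c b) d \<circ> Transposition.transpose a c"
    have q: "q permutes S" unfolding q_def
      by (intro permutes_compose permutes_swap_id) (use ab cd in \<open>auto simp: Transposition.transpose_def\<close>)
    have "q a = c" "q b = d" using ab cd by (auto simp: q_def Transposition.transpose_def)
    then show ?thesis
      using sum_permutations_compose_right[OF q, of "\<lambda>p. G (p a) (p b)"] by simp
  qed
  have "(\<Sum>c\<in>S. \<Sum>d\<in>S - {c}. \<Sum>p\<in>?P. G (p c) (p d)) =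
      (\<Sum>c\<in>S. \<Sum>d\<in>S - {c}. \<Sum>p\<in>?P. G (p a) (p b))"
    by (intro sum.cong refl same) auto
  also have "\<dots> = real (card S) * (real (card S) - 1) * (\<Sum>p\<in>?P. G (p a) (p b))"
  proof -
    have "card S \<ge> 1" using S ab by (auto simp: Suc_le_eq card_gt_0_iff)
    then show ?thesis using S by (simp add: card_Diff_singleton of_nat_diff)
  qed
  finally have 1: "(\<Sum>c\<in>S. \<Sum>d\<in>S - {c}. \<Sum>p\<in>?P. G (p c) (p d)) =
      real (card S) * (real (card S) - 1) * (\<Sum>p\<in>?P. G (p a) (p b))" .
  have "(\<Sum>c\<in>S. \<Sum>d\<in>S - {c}. G (p c) (p d)) = (\<Sum>i\<in>S. \<Sum>j\<in>S - {i}. G i j)" if "p permutes S" for p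
  proof -
    have inner: "(\<Sum>d\<in>S - {c}. G (p c) (p d)) = (\<Sum>j\<in>S - {p c}. G (p c) j)" if "c \<in> S" for c
    proof (rule sum.reindex_bij_betw)
      show "bij_betw p (S - {c}) (S - {p c})"
        using inj_on_image_set_diff[OF permutes_inj[OF \<open>p permutes S\<close>], of S "{c}"]
          permutes_image[OF \<open>p permutes S\<close>] inj_on_subset[OF permutes_inj[OF \<open>p permutes S\<close>]]
        by (simp add: bij_betw_def)
    qed
    have "(\<Sum>c\<in>S. \<Sum>d\<in>S - {c}. G (p c) (p d)) = (\<Sum>c\<in>S. \<Sum>j\<in>S - {p c}. G (p c) j)"
      by (intro sum.cong refl inner)
    also have "\<dots> = (\<Sum>i\<in>S. \<Sum>j\<in>S - {i}. G i j)"
      by (rule sum.reindex_bij_betw[OF permutes_imp_bij[OF that]])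
    finally show ?thesis .
  qed
  then have "(\<Sum>p\<in>?P. \<Sum>c\<in>S. \<Sum>d\<in>S - {c}. G (p c) (p d)) =
      real (card ?P) * (\<Sum>i\<in>S. \<Sum>j\<in>S - {i}. G i j)" by simp
  moreover have "(\<Sum>p\<in>?P. \<Sum>c\<in>S. \<Sum>d\<in>S - {c}. G (p c) (p d)) =
      (\<Sum>c\<in>S. \<Sum>d\<in>S - {c}. \<Sum>p\<in>?P. G (p c) (p d))"
    by (subst sum.swap) (intro sum.cong refl sum.swap)
  ultimately show ?thesis using 1 by simp
qed

section \<open>Independence of disjoint pairs of coordinates\<close>

context prob_space
begin

text \<open>The tuple of coordinates is the identity map, whose law is already the product of the
  marginals.\<close>

lemma indep_vars_coordinates: "finite I \<Longrightarrow> I \<noteq> {} \<Longrightarrow> prob_space.indep_vars (Pi\<^sub>M I (\<lambda>_. M)) (\<lambda>_. M) (\<lambda>i Y. Y i) I"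
proof -
  assume I: "finite I" "I \<noteq> {}"
  interpret PM: prob_space "Pi\<^sub>M I (\<lambda>_. M)" by (intro prob_space_PiM) unfold_locales
  have "distr (Pi\<^sub>M I (\<lambda>_. M)) (Pi\<^sub>M I (\<lambda>_. M)) (\<lambda>Y. \<lambda>i\<in>I. Y i) = distr (Pi\<^sub>M I (\<lambda>_. M)) (Pi\<^sub>M I (\<lambda>_. M)) (\<lambda>Y. Y)"
    by (intro distr_cong) (auto simp: space_PiM PiE_restrict)
  also have "\<dots> = Pi\<^sub>M I (\<lambda>_. M)" by simp
  also have "\<dots> = (\<Pi>\<^sub>M i\<in>I. distr (Pi\<^sub>M I (\<lambda>_. M)) M (\<lambda>Y. Y i))"
    by (intro PiM_cong refl distr_PiM_component[symmetric, where M = "\<lambda>_. M"]) unfold_locales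
  finally show ?thesis by (subst PM.indep_vars_iff_distr_eq_PiM'[OF I(2)]) auto
qed

lemma distr_PiM_pair:
  assumes I: "finite I" "i \<in> I" "j \<in> I" "i \<noteq> j"
  shows "distr (Pi\<^sub>M I (\<lambda>_. M)) (M \<Otimes>\<^sub>M M) (\<lambda>Y. (Y i, Y j)) = M \<Otimes>\<^sub>M M"
proof -
  interpret PM: prob_space "Pi\<^sub>M I (\<lambda>_. M)" by (intro prob_space_PiM) unfold_locales
  have "PM.indep_vars (\<lambda>_. M) (\<lambda>i Y. Y i) I" using I by (intro indep_vars_coordinates) auto
  then have "PM.indep_var (Pi\<^sub>M {i} (\<lambda>_. M)) (\<lambda>Y. restrict Y {i}) (Pi\<^sub>M {j} (\<lambda>_. M)) (\<lambda>Y. restrict Y {j})"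
    using PM.indep_var_restrict[of "\<lambda>_. M" "\<lambda>i Y. Y i" I "{i}" "{j}"] I by auto
  then have "PM.indep_var M ((\<lambda>y. y i) \<circ> (\<lambda>Y. restrict Y {i})) M ((\<lambda>y. y j) \<circ> (\<lambda>Y. restrict Y {j}))"
    by (rule PM.indep_var_compose) auto
  then have "PM.indep_var M (\<lambda>Y. Y i) M (\<lambda>Y. Y j)" by (simp add: comp_def)
  then have "distr (Pi\<^sub>M I (\<lambda>_. M)) M (\<lambda>Y. Y i) \<Otimes>\<^sub>M distr (Pi\<^sub>M I (\<lambda>_. M)) M (\<lambda>Y. Y j) =
      distr (Pi\<^sub>M I (\<lambda>_. M)) (M \<Otimes>\<^sub>M M) (\<lambda>Y. (Y i, Y j))"
    by (simp add: PM.indep_var_distribution_eq)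
  moreover have "distr (Pi\<^sub>M I (\<lambda>_. M)) M (\<lambda>Y. Y k) = M" if "k \<in> I" for k
    by (intro distr_PiM_component[where M = "\<lambda>_. M"] that) unfold_locales
  ultimately show ?thesis using I by simp
qed

text \<open>Functions of disjoint blocks of coordinates are independent, and each block of two has
  law \<open>M \<Otimes>\<^sub>M M\<close>.\<close>

lemma expectation_prod_disjoint_pairs:
  fixes F :: "'a \<times> 'a \<Rightarrow> real"
  assumes F[measurable]: "F \<in> borel_measurable (M \<Otimes>\<^sub>M M)" and FD: "\<And>z. \<bar>F z\<bar> \<le> D"
    and I: "finite I" and L: "finite L"
    and ab: "\<And>k. k \<in> L \<Longrightarrow> a k \<in> I \<and> b k \<in> I \<and> a k \<noteq> b k"
    and disj: "disjoint_family_on (\<lambda>k. {a k, b k}) L"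
  shows "(\<integral>Y. (\<Prod>k\<in>L. F (Y (a k), Y (b k))) \<partial>Pi\<^sub>M I (\<lambda>_. M)) = (\<integral>z. F z \<partial>(M \<Otimes>\<^sub>M M)) ^ card L"
proof (cases "L = {}")
  case True
  interpret PM: prob_space "Pi\<^sub>M I (\<lambda>_. M)" by (intro prob_space_PiM) unfold_locales
  show ?thesis using True PM.prob_space by simp
next
  case False
  interpret PM: prob_space "Pi\<^sub>M I (\<lambda>_. M)" by (intro prob_space_PiM) unfold_locales
  have Ine: "I \<noteq> {}" using False ab by blast
  have rv: "(\<lambda>Y. F (Y (a k), Y (b k))) \<in> borel_measurable (Pi\<^sub>M I (\<lambda>_. M))" if "k \<in> L" for k
    using ab[OF that] by (intro measurable_compose[OF _ F] measurable_Pair measurable_component_singleton) auto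
  have int: "integrable (Pi\<^sub>M I (\<lambda>_. M)) (\<lambda>Y. F (Y (a k), Y (b k)))" if "k \<in> L" for k
    using FD rv[OF that] by (intro PM.integrable_const_bound[where B = D]) auto
  have "PM.indep_vars (\<lambda>k. Pi\<^sub>M {a k, b k} (\<lambda>_. M)) (\<lambda>k Y. restrict (\<lambda>i. Y i) {a k, b k}) L"
    using ab by (intro PM.indep_vars_restrict[OF indep_vars_coordinates[OF I Ine] _ disj]) auto
  then have "PM.indep_vars (\<lambda>k. borel)
      (\<lambda>k Y. F (restrict (\<lambda>i. Y i) {a k, b k} (a k), restrict (\<lambda>i. Y i) {a k, b k} (b k))) L"
    by (rule PM.indep_vars_compose2[where Y = "\<lambda>k y. F (y (a k), y (b k))"])
       (intro measurable_compose[OF _ F] measurable_Pair measurable_component_singleton; simp)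
  then have ind: "PM.indep_vars (\<lambda>k. borel) (\<lambda>k Y. F (Y (a k), Y (b k))) L" by simp
  have "(\<integral>Y. (\<Prod>k\<in>L. F (Y (a k), Y (b k))) \<partial>Pi\<^sub>M I (\<lambda>_. M)) =
      (\<Prod>k\<in>L. \<integral>Y. F (Y (a k), Y (b k)) \<partial>Pi\<^sub>M I (\<lambda>_. M))"
    by (rule PM.indep_vars_lebesgue_integral[OF L ind int])
  also have "\<dots> = (\<Prod>k\<in>L. \<integral>z. F z \<partial>(M \<Otimes>\<^sub>M M))"
  proof (rule prod.cong[OF refl])
    fix k assume k: "k \<in> L"
    have "(\<integral>z. F z \<partial>distr (Pi\<^sub>M I (\<lambda>_. M)) (M \<Otimes>\<^sub>M M) (\<lambda>Y. (Y (a k), Y (b k)))) =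
        (\<integral>Y. F (Y (a k), Y (b k)) \<partial>Pi\<^sub>M I (\<lambda>_. M))"
      using ab[OF k] by (intro integral_distr measurable_Pair measurable_component_singleton F) auto
    then show "(\<integral>Y. F (Y (a k), Y (b k)) \<partial>Pi\<^sub>M I (\<lambda>_. M)) = (\<integral>z. F z \<partial>(M \<Otimes>\<^sub>M M))"
      using distr_PiM_pair[OF I, of "a k" "b k"] ab[OF k] by simp
  qed
  finally show ?thesis by simp
qed

end

section \<open>U-statistics: exponential moments and tails\<close>

definition U_stat :: "('a \<times> 'a \<Rightarrow> real) \<Rightarrow> nat \<Rightarrow> (nat \<Rightarrow> 'a) \<Rightarrow> real" where
  "U_stat g s Y = (\<Sum>i\<in>{1..s}. \<Sum>j\<in>{1..s} - {i}. g (Y i, Y j)) / (real s * (real s - 1))"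

lemma borel_measurable_U_stat [measurable]:
  assumes g[measurable]: "g \<in> borel_measurable (M \<Otimes>\<^sub>M M)"
  shows "U_stat g s \<in> borel_measurable (Pi\<^sub>M {1..s} (\<lambda>_. M))"
  unfolding U_stat_def
  by (intro borel_measurable_divide borel_measurable_sum borel_measurable_const
        measurable_compose[OF _ g] measurable_Pair measurable_component_singleton) auto

text \<open>Hoeffding's averaging: a U-statistic is the mean, over all orderings of the sample, of
  averages of \<open>s div 2\<close> independent terms.\<close>

lemma U_stat_eq_permutation_average:
  assumes s: "s \<ge> 2"
  shows "U_stat g s Y = (\<Sum>p | p permutes {1..s}. (1 / real (card {p. p permutes {1..s}})) *
    ((\<Sum>k<s div 2. g (Y (p (2 * k + 1)), Y (p (2 * k + 2)))) / real (s div 2)))"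
proof -
  let ?P = "{p. p permutes {1..s}}"
  have P: "card ?P > 0"
    using finite_permutations[of "{1..s}"] permutes_id[of "{1..s}"] unfolding card_gt_0_iff by blast
  have m: "s div 2 > 0" using s by auto
  have "(\<Sum>p\<in>?P. g (Y (p (2 * k + 1)), Y (p (2 * k + 2)))) = real (card ?P) * U_stat g s Y"
    if "k < s div 2" for k
  proof -
    have "2 * k + 1 \<in> {1..s}" "2 * k + 2 \<in> {1..s}" using that by auto
    from sum_permutations_pair[OF _ this, of "\<lambda>i j. g (Y i, Y j)"]
    have "real s * (real s - 1) * (\<Sum>p\<in>?P. g (Y (p (2 * k + 1)), Y (p (2 * k + 2)))) =
      real (card ?P) * (\<Sum>i\<in>{1..s}. \<Sum>j\<in>{1..s} - {i}. g (Y i, Y j))" by simp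
    moreover have "real s * (real s - 1) \<noteq> 0" using s by simp
    ultimately show ?thesis unfolding U_stat_def
      by (metis (no_types, lifting) nonzero_mult_div_cancel_left times_divide_eq_right)
  qed
  then have "(\<Sum>k<s div 2. \<Sum>p\<in>?P. g (Y (p (2 * k + 1)), Y (p (2 * k + 2)))) =
      real (s div 2) * (real (card ?P) * U_stat g s Y)" by simp
  then have "(\<Sum>p\<in>?P. \<Sum>k<s div 2. g (Y (p (2 * k + 1)), Y (p (2 * k + 2)))) =
      real (s div 2) * (real (card ?P) * U_stat g s Y)" by (subst sum.swap)
  then have "(\<Sum>p\<in>?P. (1 / real (card ?P)) * ((\<Sum>k<s div 2. g (Y (p (2 * k + 1)), Y (p (2 * k + 2)))) / real (s div 2)))
      = (1 / real (card ?P)) * ((real (s div 2) * (real (card ?P) * U_stat g s Y)) / real (s div 2))"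
    by (simp only: sum_distrib_left[symmetric] sum_divide_distrib[symmetric])
  also have "\<dots> = U_stat g s Y" using P m by simp
  finally show ?thesis by simp
qed

context prob_space
begin

text \<open>By convexity the exponential of the average over orderings is at most the average of the
  exponentials. Within one ordering the terms are independent and the expectation factorises; the
  dependence between different orderings never has to be controlled.\<close>

lemma U_stat_mgf_le:
  fixes g :: "'a \<times> 'a \<Rightarrow> real"
  assumes g[measurable]: "g \<in> borel_measurable (M \<Otimes>\<^sub>M M)" and D: "\<And>z. \<bar>g z\<bar> \<le> D" and s: "s \<ge> 2"
  shows "(\<integral>Y. exp (t * U_stat g s Y) \<partial>Pi\<^sub>M {1..s} (\<lambda>_. M)) \<le>
    (\<integral>z. exp (t / real (s div 2) * g z) \<partial>(M \<Otimes>\<^sub>M M)) ^ (s div 2)"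
proof -
  let ?I = "{1..s}" and ?PM = "Pi\<^sub>M {1..s} (\<lambda>_. M)" and ?P = "{p. p permutes {1..s}}"
  define m where "m = s div 2"
  define W where "W p Y = (\<Sum>k<m. g (Y (p (2 * k + 1)), Y (p (2 * k + 2)))) / real m" for p :: "nat \<Rightarrow> nat" and Y
  interpret PM: prob_space ?PM by (intro prob_space_PiM) unfold_locales
  have m: "m > 0" using s by (auto simp: m_def)
  have P: "finite ?P" "?P \<noteq> {}" using finite_permutations[of ?I] permutes_id[of ?I] by blast+
  have p_in: "p (2 * k + 1) \<in> ?I \<and> p (2 * k + 2) \<in> ?I \<and> p (2 * k + 1) \<noteq> p (2 * k + 2)"
    if "p permutes ?I" "k \<in> {..<m}" for p k
    using that(2) permutes_in_image[OF that(1)] inj_eq[OF permutes_inj[OF that(1)]] by (auto simp: m_def)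
  have W_meas: "W p \<in> borel_measurable ?PM" if "p permutes ?I" for p
    unfolding W_def using p_in[OF that]
    by (intro borel_measurable_divide borel_measurable_sum borel_measurable_const
        measurable_compose[OF _ g] measurable_Pair measurable_component_singleton) auto
  have W_bound: "\<bar>W p Y\<bar> \<le> D" for p Y
  proof -
    have "\<bar>\<Sum>k<m. g (Y (p (2 * k + 1)), Y (p (2 * k + 2)))\<bar> \<le> (\<Sum>k<m. D)"
      by (rule order_trans[OF sum_abs sum_mono[OF D]])
    then show ?thesis using m by (simp add: W_def field_simps)
  qed
  have W_int: "integrable ?PM (\<lambda>Y. exp (t * W p Y))" if "p permutes ?I" for p
    using PM.integrable_exp_bounded[OF W_meas[OF that] W_bound] .
  have W_exp: "(\<integral>Y. exp (t * W p Y) \<partial>?PM) = (\<integral>z. exp (t / real m * g z) \<partial>(M \<Otimes>\<^sub>M M)) ^ m"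
    if p: "p permutes ?I" for p
  proof -
    have "exp (t * W p Y) = (\<Prod>k<m. exp (t / real m * g (Y (p (2 * k + 1)), Y (p (2 * k + 2)))))" for Y
      unfolding W_def by (subst exp_sum[symmetric]) (auto simp: sum_distrib_left sum_divide_distrib)
    then have "(\<integral>Y. exp (t * W p Y) \<partial>?PM) =
        (\<integral>Y. (\<Prod>k<m. exp (t / real m * g (Y (p (2 * k + 1)), Y (p (2 * k + 2))))) \<partial>?PM)" by simp
    also have "\<dots> = (\<integral>z. exp (t / real m * g z) \<partial>(M \<Otimes>\<^sub>M M)) ^ card {..<m}"
    proof (rule expectation_prod_disjoint_pairs[where F = "\<lambda>z. exp (t / real m * g z)" and D = "exp (\<bar>t / real m\<bar> * D)"])
      fix z show "\<bar>exp (t / real m * g z)\<bar> \<le> exp (\<bar>t / real m\<bar> * D)"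
        using order_trans[OF abs_ge_self[of "t / real m * g z"]] mult_left_mono[OF D[of z] abs_ge_zero[of "t / real m"]]
        unfolding abs_mult[of _ "g z"] abs_exp_cancel exp_le_cancel_iff by blast
      show "disjoint_family_on (\<lambda>k. {p (2 * k + 1), p (2 * k + 2)}) {..<m}"
        unfolding disjoint_family_on_def using inj_eq[OF permutes_inj[OF p]] by (auto; presburger)
    qed (use p_in[OF p] in auto)
    finally show ?thesis by simp
  qed
  have U: "U_stat g s Y = (\<Sum>p\<in>?P. (1 / real (card ?P)) *\<^sub>R W p Y)" for Y
    unfolding U_stat_eq_permutation_average[OF s] W_def m_def by simp
  have card: "(\<Sum>p\<in>?P. 1 / real (card ?P)) = 1" using P by simp
  have convex: "exp (t * U_stat g s Y) \<le> (\<Sum>p\<in>?P. (1 / real (card ?P)) * exp (t * W p Y))" for Y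
  proof -
    have "t * U_stat g s Y = (\<Sum>p\<in>?P. (1 / real (card ?P)) *\<^sub>R (t * W p Y))"
      unfolding U by (simp add: sum_distrib_left mult.left_commute)
    then show ?thesis using convex_on_sum[OF P exp_convex card, of "\<lambda>p. t * W p Y"] by simp
  qed
  have U_bound: "\<bar>U_stat g s Y\<bar> \<le> D" for Y
  proof -
    have "\<bar>U_stat g s Y\<bar> \<le> (\<Sum>p\<in>?P. \<bar>(1 / real (card ?P)) *\<^sub>R W p Y\<bar>)" unfolding U by (rule sum_abs)
    also have "\<dots> \<le> (\<Sum>p\<in>?P. (1 / real (card ?P)) * D)"
      using W_bound by (intro sum_mono) (auto simp: abs_mult intro!: divide_right_mono)
    also have "\<dots> = D" by (simp only: sum_distrib_right[symmetric] card mult_1)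
    finally show ?thesis .
  qed
  have "(\<integral>Y. exp (t * U_stat g s Y) \<partial>?PM) \<le> (\<integral>Y. (\<Sum>p\<in>?P. (1 / real (card ?P)) * exp (t * W p Y)) \<partial>?PM)"
  proof (rule integral_mono)
    show "integrable ?PM (\<lambda>Y. exp (t * U_stat g s Y))"
      by (rule PM.integrable_exp_bounded[OF _ U_bound]) (rule borel_measurable_U_stat[OF g])
  qed (use convex W_int in auto)
  also have "\<dots> = (\<Sum>p\<in>?P. (1 / real (card ?P)) * (\<integral>z. exp (t / real m * g z) \<partial>(M \<Otimes>\<^sub>M M)) ^ m)"
    using W_int W_exp by (simp add: Bochner_Integration.integral_sum)
  also have "\<dots> = (\<integral>z. exp (t / real m * g z) \<partial>(M \<Otimes>\<^sub>M M)) ^ m"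
    by (simp only: sum_distrib_right[symmetric] card mult_1)
  finally show ?thesis by (simp add: m_def)
qed

lemma U_stat_upper_tail:
  fixes g :: "'a \<times> 'a \<Rightarrow> real"
  assumes g[measurable]: "g \<in> borel_measurable (M \<Otimes>\<^sub>M M)" and D: "\<And>z. \<bar>g z\<bar> \<le> D" and s: "s \<ge> 2"
    and b: "AE z in M \<Otimes>\<^sub>M M. \<bar>g z\<bar> \<le> b" and b0: "b \<ge> 0" and mean: "(\<integral>z. g z \<partial>(M \<Otimes>\<^sub>M M)) = 0"
    and var: "(\<integral>z. (g z)\<^sup>2 \<partial>(M \<Otimes>\<^sub>M M)) \<le> v" and v: "v > 0" and L: "L > 0"
    and a: "a = sqrt (2 * v * L / real (s div 2)) + b * L / (3 * real (s div 2))"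
  shows "measure (Pi\<^sub>M {1..s} (\<lambda>_. M)) {Y \<in> space (Pi\<^sub>M {1..s} (\<lambda>_. M)). U_stat g s Y \<ge> a} \<le> exp (- L)"
proof -
  let ?PM = "Pi\<^sub>M {1..s} (\<lambda>_. M)"
  interpret PM: prob_space ?PM by (intro prob_space_PiM) unfold_locales
  interpret MM: pair_prob_space M M ..
  define m where "m = real (s div 2)"
  have m: "m > 0" using s by (auto simp: m_def)
  \<comment> \<open>Substituting \<open>1 / t = 1 / r + c\<close> turns the quantity to be
    minimised, \<open>L\<close> plus the bound on the log moment generating function, divided by
    \<open>t\<close>, into \<open>r * v / (2 * m) + L / r + c * L\<close>. This \<open>r\<close> is
    the minimiser and \<open>a\<close> the minimum, so the Chernoff exponent is exactly
    \<open>- L\<close>.\<close>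
  define c where "c = b / (3 * m)"
  define r where "r = sqrt (2 * L * m / v)"
  define t where "t = r / (1 + c * r)"
  have c: "c \<ge> 0" using b0 m by (simp add: c_def)
  have r: "r > 0" "r\<^sup>2 = 2 * L * m / v" using L m v by (auto simp: r_def)
  have cr: "1 + c * r > 0" using c r by (simp add: add_pos_nonneg)
  have t: "t > 0" using r cr by (simp add: t_def)
  have ct: "1 - c * t = 1 / (1 + c * r)" using cr by (simp add: t_def field_simps)
  have tb: "t / m * b = 3 * (c * t)" using m by (simp add: c_def)
  have "c * t < 1" using ct cr by (metis diff_gt_0_iff_gt zero_less_divide_1_iff)
  then have tb3: "t / m * b < 3" using tb by simp
  have U_meas: "U_stat g s \<in> borel_measurable ?PM" by (rule borel_measurable_U_stat[OF g])
  have "measure ?PM {Y \<in> space ?PM. U_stat g s Y \<ge> a} \<le> exp (- t * a) * (\<integral>Y\<in>space ?PM. exp (t * U_stat g s Y) \<partial>?PM)"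
  proof (rule PM.Chernoff_ineq_ge[OF t])
    have "\<bar>U_stat g s Y\<bar> \<le> D" for Y
    proof -
      have "\<bar>\<Sum>i\<in>{1..s}. \<Sum>j\<in>{1..s} - {i}. g (Y i, Y j)\<bar> \<le> (\<Sum>i\<in>{1..s}. \<Sum>j\<in>{1..s} - {i}. D)"
        by (intro order_trans[OF sum_abs] sum_mono D)
      also have "\<dots> = real s * (real s - 1) * D" using s by (simp add: of_nat_diff)
      finally show ?thesis using s by (simp add: U_stat_def field_simps)
    qed
    then show "set_integrable ?PM (space ?PM) (\<lambda>Y. exp (t * U_stat g s Y))"
      unfolding set_integrable_def
      by (intro integrable_mult_indicator PM.integrable_exp_bounded[OF U_meas]) auto
  qed simp
  also have "(\<integral>Y\<in>space ?PM. exp (t * U_stat g s Y) \<partial>?PM) = (\<integral>Y. exp (t * U_stat g s Y) \<partial>?PM)"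
    unfolding set_lebesgue_integral_def by (intro Bochner_Integration.integral_cong) auto
  also have "exp (- t * a) * \<dots> \<le> exp (- t * a) * exp (t\<^sup>2 * v / (2 * m * (1 - c * t)))"
  proof (rule mult_left_mono)
    have "(\<integral>z. exp (t / m * g z) \<partial>(M \<Otimes>\<^sub>M M)) \<le> exp ((t / m)\<^sup>2 * v / (2 * (1 - t / m * b / 3)))"
      using t m by (intro MM.P.mgf_le_Bernstein[OF g D b mean var]) (use tb3 in auto)
    then have "(\<integral>z. exp (t / m * g z) \<partial>(M \<Otimes>\<^sub>M M)) ^ (s div 2) \<le> exp ((t / m)\<^sup>2 * v / (2 * (1 - t / m * b / 3))) ^ (s div 2)"
      by (intro power_mono) auto
    also have "\<dots> = exp (m * ((t / m)\<^sup>2 * v / (2 * (1 - c * t))))"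
    proof -
      have "1 - t / m * b / 3 = 1 - c * t" unfolding tb by simp
      then show ?thesis by (simp add: m_def flip: exp_of_nat_mult)
    qed
    also have "m * ((t / m)\<^sup>2 * v / (2 * (1 - c * t))) = t\<^sup>2 * v / (2 * m * (1 - c * t))"
    proof -
      have "m * ((t / m)\<^sup>2 * v / (2 * q)) = t\<^sup>2 * v / (2 * m * q)" for q
        using m by (cases "q = 0") (auto simp: power2_eq_square field_simps)
      then show ?thesis .
    qed
    finally show "(\<integral>Y. exp (t * U_stat g s Y) \<partial>?PM) \<le> exp (t\<^sup>2 * v / (2 * m * (1 - c * t)))"
      using U_stat_mgf_le[OF g D s, of t] unfolding m_def by (rule order_trans[rotated])
  qed simp
  also have "\<dots> = exp (- t * a + t\<^sup>2 * v / (2 * m * (1 - c * t)))" by (simp only: exp_add)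
  also have "- t * a + t\<^sup>2 * v / (2 * m * (1 - c * t)) = - L"
  proof -
    have rv: "v * r / m = sqrt (2 * v * L / m)"
    proof -
      have "(v * r / m)\<^sup>2 = 2 * v * L / m"
        using r(2) v m by (simp add: power_mult_distrib power_divide power2_eq_square field_simps)
      then show ?thesis using r(1) v m
        by (metis abs_of_nonneg divide_nonneg_pos less_imp_le mult_nonneg_nonneg real_sqrt_abs)
    qed
    have a': "a = v * r / m + c * L" unfolding a rv[unfolded m_def] c_def m_def by (simp add: rv[unfolded m_def])
    have "t\<^sup>2 * v / (2 * m * (1 - c * t)) = r\<^sup>2 * v / (2 * m) / (1 + c * r)"
    proof -
      have "(r / w)\<^sup>2 * v / (2 * m * (1 / w)) = r\<^sup>2 * v / (2 * m) / w" if "w > 0" for w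
        using that m by (simp add: power2_eq_square field_simps)
      from this[OF cr] show ?thesis unfolding ct unfolding t_def .
    qed
    also have "r\<^sup>2 * v / (2 * m) = L" unfolding r(2) using v m by simp
    finally have 1: "t\<^sup>2 * v / (2 * m * (1 - c * t)) = L / (1 + c * r)" .
    have "t * a = (r\<^sup>2 * v / m + c * L * r) / (1 + c * r)"
      unfolding a' t_def by (simp add: power2_eq_square algebra_simps add_divide_distrib)
    also have "r\<^sup>2 * v / m = 2 * L" unfolding r(2) using v m by simp
    finally have "t * a - t\<^sup>2 * v / (2 * m * (1 - c * t)) = (2 * L + c * L * r - L) / (1 + c * r)"
      unfolding 1 by (simp only: diff_divide_distrib)
    also have "\<dots> = L" using cr by (simp add: field_simps)
    finally show ?thesis by simp
  qed
  finally show ?thesis .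
qed

text \<open>Nonnegativity of \<open>h\<close> pays twice: deviations from \<theta> are at most
  \<open>b\<close> and not \<open>2 * b\<close>, and the variance is at most
  \<open>b * \<theta>\<close> since the square of \<open>h\<close> is at most
  \<open>b * h\<close>.\<close>

theorem U_stat_Bernstein:
  fixes h :: "'a \<times> 'a \<Rightarrow> real"
  assumes h[measurable]: "h \<in> borel_measurable (M \<Otimes>\<^sub>M M)" and h0: "\<And>z. 0 \<le> h z" and D: "\<And>z. h z \<le> D"
    and b: "AE z in M \<Otimes>\<^sub>M M. h z \<le> b" and mean: "(\<integral>z. h z \<partial>(M \<Otimes>\<^sub>M M)) = \<theta>" and \<theta>: "\<theta> > 0"
    and s: "s \<ge> 2" and \<delta>: "0 < \<delta>" "\<delta> < 1"
  shows "measure (Pi\<^sub>M {1..s} (\<lambda>_. M)) {Y \<in> space (Pi\<^sub>M {1..s} (\<lambda>_. M)).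
    \<bar>U_stat h s Y - \<theta>\<bar> \<le> 2 * b * ln (2 / \<delta>) / real s + sqrt (6 * b * \<theta> * ln (2 / \<delta>) / real s)} \<ge> 1 - \<delta>"
proof -
  let ?PM = "Pi\<^sub>M {1..s} (\<lambda>_. M)"
  interpret PM: prob_space ?PM by (intro prob_space_PiM) unfold_locales
  interpret MM: pair_prob_space M M ..
  define L where "L = ln (2 / \<delta>)"
  have L: "L > 0" using \<delta> by (simp add: L_def)
  have expL: "exp (- L) = \<delta> / 2" using \<delta> by (simp add: L_def exp_minus)
  have h_int: "integrable (M \<Otimes>\<^sub>M M) h"
    using h0 D by (intro MM.P.integrable_const_bound[where B = D]) auto
  have "\<theta> \<le> (\<integral>z. b \<partial>(M \<Otimes>\<^sub>M M))"
    unfolding mean[symmetric] using h_int b by (intro integral_mono_AE) auto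
  then have \<theta>b: "\<theta> \<le> b" using MM.P.prob_space by simp
  have "\<theta> \<le> (\<integral>z. D \<partial>(M \<Otimes>\<^sub>M M))"
    unfolding mean[symmetric] using h_int D by (intro integral_mono) auto
  then have \<theta>D: "\<theta> \<le> D" using MM.P.prob_space by simp
  define m where "m = real (s div 2)"
  \<comment> \<open>The worst case is \<open>s = 3\<close>, where one of three observations stays
    unpaired. This turns the 2 of the variance term into 6.\<close>
  have "s \<le> 3 * (s div 2)" using s by presburger
  then have m3: "real s \<le> 3 * m" unfolding m_def by linarith
  have m: "m > 0" using s by (auto simp: m_def)
  define a where "a = sqrt (2 * (b * \<theta>) * L / m) + b * L / (3 * m)"
  define a' where "a' = 2 * b * L / real s + sqrt (6 * b * \<theta> * L / real s)"
  have s0: "real s > 0" using s by simp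
  have aa': "a \<le> a'"
  proof -
    have "2 * (b * \<theta>) * L / m = 6 * b * \<theta> * L / (3 * m)" using m by simp
    also have "\<dots> \<le> 6 * b * \<theta> * L / real s"
      using m3 s0 \<theta>b \<theta> L by (intro divide_left_mono) auto
    finally have 1: "sqrt (2 * (b * \<theta>) * L / m) \<le> sqrt (6 * b * \<theta> * L / real s)" by simp
    have "b * L / (3 * m) \<le> b * L / real s" using m3 s0 \<theta>b \<theta> L by (intro divide_left_mono) auto
    \<comment> \<open>The linear term has room to spare; the factor 2 is that of the claimed
      bound.\<close>
    also have "\<dots> \<le> 2 * b * L / real s" using s0 \<theta>b \<theta> L by (intro divide_right_mono) auto
    finally show ?thesis using 1 unfolding a_def a'_def by linarith
  qed
  have var: "(\<integral>z. (h z - \<theta>)\<^sup>2 \<partial>(M \<Otimes>\<^sub>M M)) \<le> b * \<theta>"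
  proof -
    have h2_int: "integrable (M \<Otimes>\<^sub>M M) (\<lambda>z. (h z)\<^sup>2)"
      using h0 D by (intro MM.P.integrable_const_bound[where B = "D\<^sup>2"]) (auto intro!: AE_I2 power_mono)
    have "(\<integral>z. (h z - \<theta>)\<^sup>2 \<partial>(M \<Otimes>\<^sub>M M)) = (\<integral>z. (h z)\<^sup>2 \<partial>(M \<Otimes>\<^sub>M M)) - \<theta>\<^sup>2"
      using MM.P.variance_eq[OF h_int h2_int] mean by simp
    also have "\<dots> \<le> (\<integral>z. (h z)\<^sup>2 \<partial>(M \<Otimes>\<^sub>M M))" by simp
    also have "\<dots> \<le> (\<integral>z. b * h z \<partial>(M \<Otimes>\<^sub>M M))"
    proof (rule integral_mono_AE[OF h2_int])
      show "AE z in M \<Otimes>\<^sub>M M. (h z)\<^sup>2 \<le> b * h z"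
        using b by eventually_elim (simp add: power2_eq_square mult_right_mono h0)
    qed (use h_int in simp)
    also have "\<dots> = b * \<theta>" using mean by simp
    finally show ?thesis .
  qed
  have AEb: "AE z in M \<Otimes>\<^sub>M M. \<bar>h z - \<theta>\<bar> \<le> b" "AE z in M \<Otimes>\<^sub>M M. \<bar>\<theta> - h z\<bar> \<le> b"
    using b by (eventually_elim; use h0 \<theta> \<theta>b in \<open>smt (verit)\<close>)+
  have bD: "\<bar>h z - \<theta>\<bar> \<le> D" "\<bar>\<theta> - h z\<bar> \<le> D" for z
    using h0[of z] D[of z] \<theta> \<theta>D by (auto simp: abs_le_iff)
  have U: "U_stat (\<lambda>z. h z - \<theta>) s Y = U_stat h s Y - \<theta>" "U_stat (\<lambda>z. \<theta> - h z) s Y = \<theta> - U_stat h s Y" for Y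
    using s by (auto simp: U_stat_def sum_subtractf diff_divide_distrib of_nat_diff)
  have means: "(\<integral>z. h z - \<theta> \<partial>(M \<Otimes>\<^sub>M M)) = 0" "(\<integral>z. \<theta> - h z \<partial>(M \<Otimes>\<^sub>M M)) = 0"
    using h_int mean MM.P.prob_space by simp_all
  have up: "measure ?PM {Y \<in> space ?PM. U_stat h s Y - \<theta> \<ge> a} \<le> \<delta> / 2"
    using U_stat_upper_tail[of "\<lambda>z. h z - \<theta>" D s b "b * \<theta>" L a] AEb bD means var \<theta> \<theta>b s L
    unfolding U expL a_def m_def by simp
  have lo: "measure ?PM {Y \<in> space ?PM. \<theta> - U_stat h s Y \<ge> a} \<le> \<delta> / 2"
    using U_stat_upper_tail[of "\<lambda>z. \<theta> - h z" D s b "b * \<theta>" L a] AEb bD means var \<theta> \<theta>b s L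
    unfolding U expL a_def m_def by (simp add: power2_commute)
  note Um = borel_measurable_U_stat[OF h, of s]
  have sets: "{Y \<in> space ?PM. \<bar>U_stat h s Y - \<theta>\<bar> \<le> a'} \<in> sets ?PM"
    "{Y \<in> space ?PM. U_stat h s Y - \<theta> \<ge> a} \<in> sets ?PM" "{Y \<in> space ?PM. \<theta> - U_stat h s Y \<ge> a} \<in> sets ?PM"
    by (intro borel_measurable_le borel_measurable_abs borel_measurable_diff borel_measurable_const Um)+
  have "1 - measure ?PM {Y \<in> space ?PM. \<bar>U_stat h s Y - \<theta>\<bar> \<le> a'} = measure ?PM (space ?PM - {Y \<in> space ?PM. \<bar>U_stat h s Y - \<theta>\<bar> \<le> a'})"
    by (simp only: PM.prob_compl[OF sets(1)])
  also have "\<dots> \<le> measure ?PM ({Y \<in> space ?PM. U_stat h s Y - \<theta> \<ge> a} \<union> {Y \<in> space ?PM. \<theta> - U_stat h s Y \<ge> a})"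
  proof (rule PM.finite_measure_mono)
    show "space ?PM - {Y \<in> space ?PM. \<bar>U_stat h s Y - \<theta>\<bar> \<le> a'} \<subseteq>
        {Y \<in> space ?PM. U_stat h s Y - \<theta> \<ge> a} \<union> {Y \<in> space ?PM. \<theta> - U_stat h s Y \<ge> a}"
      using aa' by auto
  qed (use sets in blast)
  also have "\<dots> \<le> \<delta> / 2 + \<delta> / 2"
    by (rule order_trans[OF measure_Un_le[OF sets(2,3)] add_mono[OF up lo]])
  finally show ?thesis unfolding a'_def L_def by simp
qed

end

section \<open>The covariance operator of an RKHS\<close>

lemma has_sum_finite_sum:
  fixes f :: "'i \<Rightarrow> 'a \<Rightarrow> real"
  assumes "finite I" "\<And>i. i \<in> I \<Longrightarrow> (f i has_sum a i) A"
  shows "((\<lambda>x. \<Sum>i\<in>I. f i x) has_sum (\<Sum>i\<in>I. a i)) A"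
  using assms by (induction I rule: finite_induct) (auto intro: has_sum_add)

section \<open>Kernel sections and differences of kernel sections\<close>

locale rkhs_prob = prob_space P for P :: "'x::second_countable_topology measure" +
  fixes evf :: "'h::{real_inner,complete_space} \<Rightarrow> 'x \<Rightarrow> real"
    and K :: "'x \<Rightarrow> 'x \<Rightarrow> real" and \<kappa> :: real
  assumes sets_P: "sets P = sets borel" and rkhs: "is_rkhs evf K"
    and K_cont: "continuous_on UNIV (\<lambda>(x, y). K x y)" and K_bound: "\<And>x. K x x \<le> \<kappa>"
begin

abbreviation k :: "'x \<Rightarrow> 'h" where "k \<equiv> ker_section evf K"

lemma ker_section: "evf (k y) = (\<lambda>x. K x y)" and reproducing: "evf f y = f \<bullet> k y"
proof -
  from rkhs obtain k' where k': "evf k' = (\<lambda>x. K x y)" "\<And>f. evf f y = f \<bullet> k'"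
    and inj: "inj evf" unfolding is_rkhs_def by blast
  have "k y = k'" unfolding ker_section_def
    by (rule the_equality) (use k' inj in \<open>auto simp: inj_def\<close>)
  then show "evf (k y) = (\<lambda>x. K x y)" "evf f y = f \<bullet> k y" using k' by auto
qed

lemma inner_k: "k x \<bullet> k y = K y x"
  using reproducing[of "k x" y] by (simp add: ker_section)

lemma K_sym: "K x y = K y x"
  by (metis inner_commute inner_k)

lemma eqI_k: "(\<And>x. f \<bullet> k x = g \<bullet> k x) \<Longrightarrow> f = g"
  using rkhs reproducing unfolding is_rkhs_def inj_def by (metis ext)

lemma norm_k: "(norm (k x))\<^sup>2 \<le> \<kappa>"
  using K_bound[of x] by (simp add: power2_norm_eq_inner inner_k)

lemma kappa_nonneg: "0 \<le> \<kappa>"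
  using norm_k[of undefined] zero_le_power2 order_trans by blast

lemma norm_k_le: "norm (k x) \<le> sqrt \<kappa>"
  using norm_k[of x] by (simp add: real_le_rsqrt)

text \<open>The squared distance of two kernel sections is a combination of three kernel values, so
  joint continuity of \<open>K\<close>, also along the diagonal, carries over to the norm.\<close>

lemma continuous_k: "continuous_on UNIV k"
  unfolding continuous_on_def
proof
  fix x
  have K1: "continuous_on UNIV (\<lambda>y. K (a y) (b y))" if "continuous_on UNIV a" "continuous_on UNIV b"
    for a b :: "'x \<Rightarrow> 'x"
    using continuous_on_compose2[OF K_cont continuous_on_Pair[OF that]] by simp
  have "((\<lambda>y. K y y - 2 * K x y + K x x) \<longlongrightarrow> K x x - 2 * K x x + K x x) (at x)"
    using K1[OF continuous_on_id continuous_on_id] K1[OF continuous_on_const continuous_on_id]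
    by (intro tendsto_intros) (auto simp: continuous_on_def)
  then have "((\<lambda>y. sqrt (K y y - 2 * K x y + K x x)) \<longlongrightarrow> sqrt 0) (at x)"
    by (intro tendsto_real_sqrt) simp
  moreover have "sqrt (K y y - 2 * K x y + K x x) = norm (k y - k x)" for y
    using K_sym[of x y] by (simp add: norm_eq_sqrt_inner inner_simps inner_k)
  ultimately have "((\<lambda>y. norm (k y - k x)) \<longlongrightarrow> 0) (at x)" by simp
  then show "(k \<longlongrightarrow> k x) (at x)"
    by (rule LIM_zero_cancel[OF tendsto_norm_zero_cancel])
qed

text \<open>Differences over an independent pair stand in for centring by the mean embedding, so no
  Hilbert-space valued integral is needed; \<open>Sigma_hat\<close> is built from the same
  vectors.\<close>

definition u :: "'x \<times> 'x \<Rightarrow> 'h" where "u z = k (fst z) - k (snd z)"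

lemma continuous_u: "continuous_on UNIV u"
  unfolding u_def
  by (intro continuous_intros continuous_on_compose2[OF continuous_k]) auto

lemma norm_u: "norm (u z) \<le> 2 * sqrt \<kappa>"
  using norm_triangle_ineq4[of "k (fst z)" "k (snd z)"] norm_k_le[of "fst z"] norm_k_le[of "snd z"]
  by (simp add: u_def)

lemma borel_measurable_P: "continuous_on UNIV f \<Longrightarrow> f \<in> borel_measurable P"
  for f :: "'x \<Rightarrow> real"
  using borel_measurable_continuous_onI measurable_cong_sets[OF sets_P refl] by blast

text \<open>Second countability enters here: the product of the Borel sigma-algebras is the Borel
  sigma-algebra of the product space.\<close>

lemma borel_measurable_PP: "continuous_on UNIV f \<Longrightarrow> f \<in> borel_measurable (P \<Otimes>\<^sub>M P)"
  for f :: "'x \<times> 'x \<Rightarrow> real"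
proof -
  assume "continuous_on UNIV f"
  then have "f \<in> borel_measurable borel" by (rule borel_measurable_continuous_onI)
  moreover have "sets (P \<Otimes>\<^sub>M P) = sets (borel :: ('x \<times> 'x) measure)"
    unfolding borel_prod[symmetric] using sets_P by (intro sets_pair_measure_cong)
  ultimately show ?thesis using measurable_cong_sets by blast
qed

lemma borel_measurable_evf [measurable]: "(\<lambda>x. f \<bullet> k x) \<in> borel_measurable P"
  by (intro borel_measurable_P continuous_intros continuous_k)

lemma evf_bound: "\<bar>f \<bullet> k x\<bar> \<le> norm f * sqrt \<kappa>"
  using Cauchy_Schwarz_ineq2[of f "k x"] mult_left_mono[OF norm_k_le norm_ge_zero] order_trans by blast

section \<open>The centred embedding into the square-integrable functions\<close>

lemma incl_eq: "incl evf P f = (\<lambda>x. f \<bullet> k x - expectation (\<lambda>y. f \<bullet> k y))"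
  by (simp add: incl_def reproducing)

lemma integrable_evf [simp]: "integrable P (\<lambda>x. f \<bullet> k x)"
  using evf_bound by (intro integrable_const_bound[where B = "norm f * sqrt \<kappa>"]) auto

lemma borel_measurable_incl [measurable]: "incl evf P f \<in> borel_measurable P"
  unfolding incl_eq by simp

lemma incl_bound: "\<bar>incl evf P f x\<bar> \<le> 2 * (norm f * sqrt \<kappa>)"
proof -
  have "\<bar>expectation (\<lambda>y. f \<bullet> k y)\<bar> \<le> expectation (\<lambda>y. \<bar>f \<bullet> k y\<bar>)" by (rule integral_abs_bound)
  also have "\<dots> \<le> expectation (\<lambda>y. norm f * sqrt \<kappa>)" by (intro integral_mono) (auto simp: evf_bound)
  also have "\<dots> = norm f * sqrt \<kappa>" using prob_space by simp
  finally show ?thesis using evf_bound[of f x] unfolding incl_eq by linarith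
qed

lemma incl_add: "incl evf P (f + g) x = incl evf P f x + incl evf P g x"
  and incl_scale: "incl evf P (c *\<^sub>R f) x = c * incl evf P f x"
  by (simp_all add: incl_eq inner_simps algebra_simps)

lemma expectation_incl: "expectation (incl evf P f) = 0"
  unfolding incl_eq using prob_space by simp

lemma L2_measurable: "g \<in> L2_space P \<Longrightarrow> g \<in> borel_measurable P"
  by (simp add: L2_space_def)

lemma L2_product: "f \<in> L2_space P \<Longrightarrow> g \<in> L2_space P \<Longrightarrow> integrable P (\<lambda>x. f x * g x)"
proof -
  assume fg: "f \<in> L2_space P" "g \<in> L2_space P"
  note [measurable] = L2_measurable[OF fg(1)] L2_measurable[OF fg(2)]
  have "integrable P (\<lambda>x. (f x)\<^sup>2 + (g x)\<^sup>2)" using fg by (simp add: L2_space_def)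
  then show ?thesis
  proof (rule Bochner_Integration.integrable_bound)
    have "\<bar>f x * g x\<bar> \<le> (f x)\<^sup>2 + (g x)\<^sup>2" for x
    proof -
      have "0 \<le> (\<bar>f x\<bar> - \<bar>g x\<bar>)\<^sup>2" by simp
      then have "2 * (\<bar>f x\<bar> * \<bar>g x\<bar>) \<le> (f x)\<^sup>2 + (g x)\<^sup>2" by (simp add: power2_diff)
      moreover have "0 \<le> \<bar>f x\<bar> * \<bar>g x\<bar>" by simp
      ultimately show ?thesis unfolding abs_mult by linarith
    qed
    then show "AE x in P. norm (f x * g x) \<le> norm ((f x)\<^sup>2 + (g x)\<^sup>2)" by (simp add: abs_of_nonneg)
  qed simp
qed

lemma L2_bounded: "f \<in> borel_measurable P \<Longrightarrow> (\<And>x. \<bar>f x\<bar> \<le> C) \<Longrightarrow> f \<in> L2_space P"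
proof -
  assume [measurable]: "f \<in> borel_measurable P" and C: "\<And>x. \<bar>f x\<bar> \<le> C"
  have "\<bar>(f x)\<^sup>2\<bar> \<le> C\<^sup>2" for x using power_mono[OF C abs_ge_zero, of x 2] by simp
  then have "integrable P (\<lambda>x. (f x)\<^sup>2)"
    by (intro integrable_const_bound[where B = "C\<^sup>2"]) auto
  then show ?thesis by (simp add: L2_space_def)
qed

lemma L2_incl: "incl evf P f \<in> L2_space P"
  by (rule L2_bounded[OF borel_measurable_incl incl_bound])

lemma L2_diff_scaled:
  assumes "f \<in> L2_space P" "g \<in> L2_space P"
  shows "(\<lambda>x. f x - c * g x) \<in> L2_space P"
proof -
  note [measurable] = L2_measurable[OF assms(1)] L2_measurable[OF assms(2)]
  have "integrable P (\<lambda>x. (f x)\<^sup>2 + c\<^sup>2 * (g x)\<^sup>2 - 2 * c * (f x * g x))"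
    using assms L2_product[OF assms] by (simp add: L2_space_def)
  also have "(\<lambda>x. (f x)\<^sup>2 + c\<^sup>2 * (g x)\<^sup>2 - 2 * c * (f x * g x)) = (\<lambda>x. (f x - c * g x)\<^sup>2)"
    by (simp add: power2_eq_square algebra_simps)
  finally show ?thesis by (simp add: L2_space_def)
qed

lemma L2_norm_eq_0_AE: "f \<in> L2_space P \<Longrightarrow> L2_norm P f = 0 \<Longrightarrow> AE x in P. f x = 0"
proof -
  assume f: "f \<in> L2_space P" and "L2_norm P f = 0"
  then have "(\<integral>x. (f x)\<^sup>2 \<partial>P) = 0" by (simp add: L2_norm_def L2_inner_def power2_eq_square)
  then show ?thesis
    using integral_nonneg_eq_0_iff_AE[of P "\<lambda>x. (f x)\<^sup>2"] f by (simp add: L2_space_def)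
qed

lemma L2_inner_cong_AE:
  assumes "AE x in P. g x = g' x" "f \<in> borel_measurable P" "g \<in> borel_measurable P" "g' \<in> borel_measurable P"
  shows "L2_inner P f g = L2_inner P f g'"
  unfolding L2_inner_def by (rule integral_cong_AE) (use assms in auto)

lemma L2_inner_commute: "L2_inner P f g = L2_inner P g f"
  by (simp add: L2_inner_def mult.commute)

text \<open>\<open>S\<close> is the topological support: the complement of the union of all open
  null sets, which is itself null because countably many of them suffice. If \<open>f\<close> is
  almost surely \<open>c\<close>, then the set where \<open>f\<close> differs from \<open>c\<close>
  is one of those open sets.\<close>

lemma support_exists:
  "\<exists>S. closed S \<and> (AE x in P. x \<in> S) \<and>
    (\<forall>f c x. continuous_on UNIV f \<longrightarrow> (AE x in P. f x = (c::real)) \<longrightarrow> x \<in> S \<longrightarrow> f x = c)"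
proof -
  let ?F = "{U :: 'x set. open U \<and> (AE x in P. x \<notin> U)}"
  obtain F' where F': "F' \<subseteq> ?F" "countable F'" "\<Union>F' = \<Union>?F" using Lindelof[of ?F] by blast
  have "AE x in P. \<forall>U\<in>F'. x \<notin> U" using F'(1,2) by (intro AE_ball_countable') auto
  then have 1: "AE x in P. x \<in> - \<Union>?F" unfolding F'(3)[symmetric] by auto
  have "f x = c" if "continuous_on UNIV f" "AE x in P. f x = (c::real)" "x \<in> - \<Union>?F" for f x and c :: real
  proof (rule ccontr)
    assume "f x \<noteq> c"
    moreover have "open {x. f x \<noteq> c}" using that(1) by (intro open_Collect_neq continuous_intros)
    moreover have "AE x in P. x \<notin> {x. f x \<noteq> c}" using that(2) by simp
    ultimately show False using that(3) by blast
  qed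
  moreover have "closed (- \<Union>?F)" by (intro closed_Compl open_Union) auto
  ultimately show ?thesis using 1 by blast
qed

text \<open>Riesz representation supplies the vector described in the definition of the adjoint;
  testing the difference of two candidates against itself shows that it is unique.\<close>

lemma incl_adj:
  assumes g: "g \<in> L2_space P"
  shows "f \<bullet> incl_adj evf P g = L2_inner P (incl evf P f) g"
proof -
  let ?\<phi> = "\<lambda>f. L2_inner P (incl evf P f) g"
  note [measurable] = L2_measurable[OF g]
  have g1: "integrable P g"
    using L2_product[OF g L2_bounded[of "\<lambda>_. 1" 1]] by simp
  have "bounded_linear ?\<phi>"
  proof (rule bounded_linear_intro)
    fix f f' c
    show "?\<phi> (f + f') = ?\<phi> f + ?\<phi> f'" "?\<phi> (c *\<^sub>R f) = c *\<^sub>R ?\<phi> f"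
      using L2_product[OF L2_incl g] by (simp_all add: L2_inner_def incl_add incl_scale algebra_simps)
    have "\<bar>?\<phi> f\<bar> \<le> (\<integral>x. \<bar>incl evf P f x * g x\<bar> \<partial>P)" unfolding L2_inner_def by (rule integral_abs_bound)
    also have "\<dots> \<le> (\<integral>x. 2 * (norm f * sqrt \<kappa>) * \<bar>g x\<bar> \<partial>P)"
    proof (rule integral_mono)
      show "integrable P (\<lambda>x. \<bar>incl evf P f x * g x\<bar>)" using L2_product[OF L2_incl[of f] g] by simp
    qed (use g1 incl_bound[of f] in \<open>auto simp: abs_mult intro!: mult_right_mono\<close>)
    also have "\<dots> = norm f * (2 * sqrt \<kappa> * (\<integral>x. \<bar>g x\<bar> \<partial>P))" by simp
    finally show "norm (?\<phi> f) \<le> norm f * (2 * sqrt \<kappa> * (\<integral>x. \<bar>g x\<bar> \<partial>P))" by simp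
  qed
  then obtain h where h: "\<And>f. ?\<phi> f = f \<bullet> h" using Riesz_representation by blast
  have "incl_adj evf P g = h" unfolding incl_adj_def
  proof (rule the_equality)
    fix h' assume "\<forall>f. f \<bullet> h' = ?\<phi> f"
    then have "(h' - h) \<bullet> (h' - h) = 0" using h by (simp add: inner_diff_right)
    then show "h' = h" by simp
  qed (simp add: h)
  then show ?thesis using h by simp
qed

section \<open>The covariance operator\<close>

abbreviation "\<Sigma> \<equiv> Sigma0 evf P"

text \<open>\<open>Blinfun\<close> can be evaluated only once boundedness is known. Pairing the
  image of \<open>a\<close> with itself and cancelling one factor of its norm gives the constant
  \<open>4 * \<kappa>\<close>, since centring at most doubles the sup bound of each factor.\<close>

lemma inner_Sigma0: "f \<bullet> \<Sigma> g = L2_inner P (incl evf P f) (incl evf P g)"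
proof -
  let ?S = "\<lambda>f. incl_adj evf P (incl evf P f)"
  have S: "f \<bullet> ?S g = L2_inner P (incl evf P f) (incl evf P g)" for f g
    by (rule incl_adj[OF L2_incl])
  have eqI: "a = b" if "\<And>f. f \<bullet> a = f \<bullet> b" for a b :: 'h
  proof -
    have "(a - b) \<bullet> (a - b) = 0" using that[of "a - b"] by (simp add: inner_diff_right)
    then show ?thesis by simp
  qed
  have "bounded_linear ?S"
  proof (rule bounded_linear_intro)
    fix a b c
    show "?S (a + b) = ?S a + ?S b" "?S (c *\<^sub>R a) = c *\<^sub>R ?S a"
      using L2_product[OF L2_incl L2_incl]
      by (auto intro!: eqI simp: inner_add_right S L2_inner_def incl_add incl_scale algebra_simps)
    have "(norm (?S a))\<^sup>2 = L2_inner P (incl evf P (?S a)) (incl evf P a)"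
      unfolding power2_norm_eq_inner S ..
    also have "\<dots> \<le> (\<integral>x. (2 * (norm (?S a) * sqrt \<kappa>)) * (2 * (norm a * sqrt \<kappa>)) \<partial>P)"
      unfolding L2_inner_def
    proof (rule integral_mono[OF L2_product[OF L2_incl L2_incl]])
      fix x
      have "incl evf P (?S a) x * incl evf P a x \<le> \<bar>incl evf P (?S a) x\<bar> * \<bar>incl evf P a x\<bar>"
        by (metis abs_ge_self abs_mult)
      also have "\<dots> \<le> (2 * (norm (?S a) * sqrt \<kappa>)) * (2 * (norm a * sqrt \<kappa>))"
        using kappa_nonneg by (intro mult_mono incl_bound) auto
      finally show "incl evf P (?S a) x * incl evf P a x \<le> (2 * (norm (?S a) * sqrt \<kappa>)) * (2 * (norm a * sqrt \<kappa>))" .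
    qed simp
    also have "\<dots> = norm (?S a) * (norm a * (4 * \<kappa>))"
      using prob_space kappa_nonneg by (simp add: algebra_simps)
    finally have "norm (?S a) * norm (?S a) \<le> norm (?S a) * (norm a * (4 * \<kappa>))"
      by (simp add: power2_eq_square)
    then show "norm (?S a) \<le> norm a * (4 * \<kappa>)"
      using kappa_nonneg by (cases "norm (?S a) = 0") (auto simp: mult_le_cancel_left)
  qed
  then have "\<Sigma> f = ?S f" for f unfolding Sigma0_def by (simp add: bounded_linear_Blinfun_apply)
  then show "f \<bullet> \<Sigma> g = L2_inner P (incl evf P f) (incl evf P g)" by (simp add: S)
qed

lemma pos_Sigma0: "pos_op \<Sigma>"
  unfolding pos_op_def
proof (intro conjI allI)
  fix f g
  have sym: "L2_inner P (incl evf P f) (incl evf P g) = L2_inner P (incl evf P g) (incl evf P f)"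
    by (simp add: L2_inner_def mult.commute)
  show "\<Sigma> f \<bullet> g = f \<bullet> \<Sigma> g" by (simp add: inner_commute[of _ g] inner_Sigma0 sym)
  show "0 \<le> \<Sigma> f \<bullet> f" by (simp add: inner_commute[of _ f] inner_Sigma0 L2_inner_def)
qed

interpretation PP: pair_prob_space P P ..

text \<open>Centring does not change differences, so \<open>f\<close> and \<open>g\<close> may be
  replaced by their centred versions. The cross terms then integrate to zero and the two remaining
  terms agree, whence the factor 1/2.\<close>

lemma inner_Sigma0_pair: "f \<bullet> \<Sigma> g = (1/2) * (\<integral>z. (f \<bullet> u z) * (g \<bullet> u z) \<partial>(P \<Otimes>\<^sub>M P))"
proof -
  let ?F = "incl evf P f" and ?G = "incl evf P g"
  have FG: "(f \<bullet> u (x, y)) * (g \<bullet> u (x, y)) = (?F x - ?F y) * (?G x - ?G y)" for x y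
    by (simp add: incl_eq u_def inner_diff_right)
  have [measurable]: "(\<lambda>z. (f \<bullet> u z) * (g \<bullet> u z)) \<in> borel_measurable (P \<Otimes>\<^sub>M P)"
    by (intro borel_measurable_PP continuous_intros continuous_u)
  have b: "\<bar>f \<bullet> u z\<bar> \<le> norm f * (2 * sqrt \<kappa>)" for f z
    using Cauchy_Schwarz_ineq2[of f "u z"] mult_left_mono[OF norm_u norm_ge_zero] order_trans by blast
  have int: "integrable (P \<Otimes>\<^sub>M P) (\<lambda>z. (f \<bullet> u z) * (g \<bullet> u z))"
  proof (rule PP.integrable_const_bound[where B = "(norm f * (2 * sqrt \<kappa>)) * (norm g * (2 * sqrt \<kappa>))"])
    have "\<bar>(f \<bullet> u z) * (g \<bullet> u z)\<bar> \<le> (norm f * (2 * sqrt \<kappa>)) * (norm g * (2 * sqrt \<kappa>))" for z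
      unfolding abs_mult using kappa_nonneg by (intro mult_mono b) auto
    then show "AE z in P \<Otimes>\<^sub>M P. norm ((f \<bullet> u z) * (g \<bullet> u z)) \<le> (norm f * (2 * sqrt \<kappa>)) * (norm g * (2 * sqrt \<kappa>))"
      by (intro AE_I2) simp
  qed simp
  have i: "integrable P ?F" "integrable P ?G" "integrable P (\<lambda>x. ?F x * ?G x)"
    using L2_product[OF L2_incl L2_incl] incl_bound
    by (auto intro!: integrable_const_bound[OF AE_I2])
  have "(\<integral>z. (f \<bullet> u z) * (g \<bullet> u z) \<partial>(P \<Otimes>\<^sub>M P)) = (\<integral>x. (\<integral>y. (?F x - ?F y) * (?G x - ?G y) \<partial>P) \<partial>P)"
    using PP.integral_fst'[OF int] by (simp only: FG)
  also have "\<dots> = (\<integral>x. ?F x * ?G x + (\<integral>y. ?F y * ?G y \<partial>P) \<partial>P)"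
  proof (rule Bochner_Integration.integral_cong[OF refl])
    fix x
    have "(\<integral>y. (?F x - ?F y) * (?G x - ?G y) \<partial>P) =
        (\<integral>y. ?F x * ?G x - ?F x * ?G y - ?G x * ?F y + ?F y * ?G y \<partial>P)"
      by (simp add: algebra_simps)
    also have "\<dots> = ?F x * ?G x - ?F x * expectation ?G - ?G x * expectation ?F + (\<integral>y. ?F y * ?G y \<partial>P)"
      using i prob_space by simp
    finally show "(\<integral>y. (?F x - ?F y) * (?G x - ?G y) \<partial>P) = ?F x * ?G x + (\<integral>y. ?F y * ?G y \<partial>P)"
      by (simp add: expectation_incl)
  qed
  also have "\<dots> = 2 * (\<integral>y. ?F y * ?G y \<partial>P)" using i prob_space by simp
  finally show ?thesis by (simp add: inner_Sigma0 L2_inner_def)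
qed

text \<open>Each kernel section has only countably many nonzero coefficients. A basis vector
  orthogonal to the sections at a countable dense set of points would be a continuous function
  vanishing on a dense set, hence zero.\<close>

lemma countable_orthonormal_basis:
  assumes E: "orthonormal_basis E"
  shows "countable (E :: 'h set)"
proof -
  obtain D :: "'x set" where D: "countable D" "\<And>U. open U \<Longrightarrow> U \<noteq> {} \<Longrightarrow> \<exists>d\<in>D. d \<in> U"
    using countable_dense_setE by blast
  have "countable {e \<in> E. (k x \<bullet> e) * (k x \<bullet> e) \<noteq> 0}" for x
    using Parseval[OF E, of "k x" "k x"] by (intro summable_countable_real) (auto simp: summable_on_def)
  then have "countable (\<Union>x\<in>D. {e \<in> E. (k x \<bullet> e) * (k x \<bullet> e) \<noteq> 0})" using D(1) by blast
  moreover have "E \<subseteq> (\<Union>x\<in>D. {e \<in> E. (k x \<bullet> e) * (k x \<bullet> e) \<noteq> 0})"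
  proof
    fix e assume e: "e \<in> E"
    then have "e \<noteq> 0" using E by (auto simp: orthonormal_basis_def)
    then obtain x where "e \<bullet> k x \<noteq> 0" using eqI_k[of e 0] by auto
    moreover have "open {x. e \<bullet> k x \<noteq> 0}"
      by (intro open_Collect_neq continuous_intros continuous_k)
    ultimately obtain d where "d \<in> D" "e \<bullet> k d \<noteq> 0" using D(2) by blast
    then show "e \<in> (\<Union>x\<in>D. {e \<in> E. (k x \<bullet> e) * (k x \<bullet> e) \<noteq> 0})"
      using e by (auto simp: inner_commute)
  qed
  ultimately show ?thesis by (rule countable_subset[rotated])
qed

section \<open>Parseval's identity under the integral sign\<close>

lemma continuous_blinfun_u: "continuous_on UNIV (\<lambda>z. blinfun_apply R (u z))"
  by (intro continuous_intros continuous_u)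

lemma norm_blinfun_u: "norm (blinfun_apply R (u z)) \<le> norm R * (2 * sqrt \<kappa>)"
  using norm_blinfun[of R "u z"] mult_left_mono[OF norm_u norm_ge_zero] order_trans by blast

lemma integrable_inner_u:
  fixes R S :: "'h \<Rightarrow>\<^sub>L 'h"
  shows "integrable (P \<Otimes>\<^sub>M P) (\<lambda>z. blinfun_apply R (u z) \<bullet> blinfun_apply S (u z))"
proof (rule PP.integrable_const_bound[where B = "(norm R * (2 * sqrt \<kappa>)) * (norm S * (2 * sqrt \<kappa>))"])
  have "\<bar>R (u z) \<bullet> S (u z)\<bar> \<le> (norm R * (2 * sqrt \<kappa>)) * (norm S * (2 * sqrt \<kappa>))" for z
    by (rule order_trans[OF Cauchy_Schwarz_ineq2 mult_mono])
       (auto intro!: norm_blinfun_u mult_nonneg_nonneg simp: kappa_nonneg)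
  then show "AE z in P \<Otimes>\<^sub>M P. norm (R (u z) \<bullet> S (u z)) \<le> (norm R * (2 * sqrt \<kappa>)) * (norm S * (2 * sqrt \<kappa>))"
    by (intro AE_I2) simp
  show "(\<lambda>z. R (u z) \<bullet> S (u z)) \<in> borel_measurable (P \<Otimes>\<^sub>M P)"
    by (intro borel_measurable_PP continuous_on_inner continuous_blinfun_u)
qed

text \<open>A product of two coordinates along \<open>e\<close> is an inner product after composing
  one operator with the rank-one projection \<open>tensor_op e e\<close>.\<close>

lemma integrable_coord_u:
  fixes R S :: "'h \<Rightarrow>\<^sub>L 'h"
  shows "integrable (P \<Otimes>\<^sub>M P) (\<lambda>z. (blinfun_apply R (u z) \<bullet> e) * (blinfun_apply S (u z) \<bullet> e))"
  using integrable_inner_u[of "tensor_op e e o\<^sub>L R" "S"]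
  by (simp add: tensor_op_apply inner_commute mult.commute)

lemma integrable_coord_u_sq:
  fixes R :: "'h \<Rightarrow>\<^sub>L 'h"
  shows "integrable (P \<Otimes>\<^sub>M P) (\<lambda>z. (blinfun_apply R (u z) \<bullet> e)\<^sup>2)"
  using integrable_coord_u[of R e R] by (simp add: power2_eq_square)

lemma integrable_norm_u_sq:
  fixes R :: "'h \<Rightarrow>\<^sub>L 'h"
  shows "integrable (P \<Otimes>\<^sub>M P) (\<lambda>z. (norm (blinfun_apply R (u z)))\<^sup>2)"
  using integrable_inner_u[of R R] by (simp add: power2_norm_eq_inner)

lemma sum_integral_coord_le:
  fixes R :: "'h \<Rightarrow>\<^sub>L 'h"
  assumes "orthonormal F" "finite F"
  shows "(\<Sum>e\<in>F. \<integral>z. (blinfun_apply R (u z) \<bullet> e)\<^sup>2 \<partial>(P \<Otimes>\<^sub>M P)) \<le> (\<integral>z. (norm (blinfun_apply R (u z)))\<^sup>2 \<partial>(P \<Otimes>\<^sub>M P))"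
proof -
  have "(\<Sum>e\<in>F. \<integral>z. (R (u z) \<bullet> e)\<^sup>2 \<partial>(P \<Otimes>\<^sub>M P)) = (\<integral>z. (\<Sum>e\<in>F. (R (u z) \<bullet> e)\<^sup>2) \<partial>(P \<Otimes>\<^sub>M P))"
    by (rule Bochner_Integration.integral_sum[symmetric]) (rule integrable_coord_u_sq)
  also have "\<dots> \<le> (\<integral>z. (norm (R (u z)))\<^sup>2 \<partial>(P \<Otimes>\<^sub>M P))"
    by (intro integral_mono Bochner_Integration.integrable_sum integrable_coord_u_sq integrable_norm_u_sq
        Bessel_inequality[OF assms subset_refl])
  finally show ?thesis .
qed

text \<open>Bessel's inequality bounds the sum by the integral. The converse needs dominated
  convergence, hence a sequence instead of a net, which is why countability of the basis
  matters.\<close>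

lemma has_sum_integral_coord_sq:
  fixes R :: "'h \<Rightarrow>\<^sub>L 'h"
  assumes E: "orthonormal_basis E"
  shows "((\<lambda>e. \<integral>z. (blinfun_apply R (u z) \<bullet> e)\<^sup>2 \<partial>(P \<Otimes>\<^sub>M P)) has_sum
    (\<integral>z. (norm (blinfun_apply R (u z)))\<^sup>2 \<partial>(P \<Otimes>\<^sub>M P))) E"
proof -
  let ?f = "\<lambda>e. \<integral>z. (R (u z) \<bullet> e)\<^sup>2 \<partial>(P \<Otimes>\<^sub>M P)" and ?J = "\<integral>z. (norm (R (u z)))\<^sup>2 \<partial>(P \<Otimes>\<^sub>M P)"
  have oE: "orthonormal E" using E by (simp add: orthonormal_basis_iff)
  have le: "sum ?f F \<le> ?J" if "finite F" "F \<subseteq> E" for F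
    using sum_integral_coord_le[of F R] that orthonormal_subset[OF oE] by blast
  have sm: "?f summable_on E"
    by (rule nonneg_bdd_above_summable_on) (auto intro!: bdd_aboveI[of _ ?J] le)
  obtain a where a: "(?f has_sum a) E" using sm by (auto simp: summable_on_def)
  have "a \<le> ?J" using a le by (rule has_sum_le_finite_sums)
  moreover have "?J \<le> a"
  proof (cases "E = {}")
    case True
    then have "R (u z) = 0" for z
      using infsumI[OF Parseval[OF E, of "R (u z)" "R (u z)"]] by simp
    then show ?thesis using has_sum_nonneg[OF a] by simp
  next
    case False
    \<comment> \<open>Initial segments of an enumeration are cofinal among the finite subsets; for a
      finite basis the enumeration merely repeats elements.\<close>
    define F where "F n = from_nat_into E ` {..<n}" for n :: nat
    have ran: "range (from_nat_into E) = E"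
      using range_from_nat_into[OF False countable_orthonormal_basis[OF E]] .
    have F: "finite (F n)" "F n \<subseteq> E" for n using ran by (auto simp: F_def)
    have flim: "filterlim F (finite_subsets_at_top E) sequentially"
      unfolding filterlim_finite_subsets_at_top
    proof (intro allI impI)
      fix X assume X: "finite X \<and> X \<subseteq> E"
      then obtain N where N: "X \<subseteq> F N"
      proof -
        have "\<exists>n. e = from_nat_into E n" if "e \<in> X" for e using X that ran by blast
        then obtain i where i: "\<And>e. e \<in> X \<Longrightarrow> e = from_nat_into E (i e)" by metis
        have "X \<subseteq> F (Suc (Max (i ` X)))"
        proof
          fix e assume "e \<in> X"
          then have "i e \<le> Max (i ` X)" using X by (intro Max_ge) auto
          then show "e \<in> F (Suc (Max (i ` X)))" using i[OF \<open>e \<in> X\<close>] by (force simp: F_def)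
        qed
        then show ?thesis by (rule that)
      qed
      have "F N \<subseteq> F n" if "n \<ge> N" for n using that by (auto simp: F_def)
      then show "\<forall>\<^sub>F n in sequentially. finite (F n) \<and> X \<subseteq> F n \<and> F n \<subseteq> E"
        using F N by (intro eventually_sequentiallyI[of N]) blast
    qed
    have lim: "(\<lambda>n. \<integral>z. (\<Sum>e\<in>F n. (R (u z) \<bullet> e)\<^sup>2) \<partial>(P \<Otimes>\<^sub>M P)) \<longlonglongrightarrow> ?J"
    proof (rule integral_dominated_convergence[where w = "\<lambda>z. (norm (R (u z)))\<^sup>2"])
      show "(\<lambda>z. (norm (R (u z)))\<^sup>2) \<in> borel_measurable (P \<Otimes>\<^sub>M P)"
        using integrable_norm_u_sq by (rule borel_measurable_integrable)
      show "(\<lambda>z. \<Sum>e\<in>F n. (R (u z) \<bullet> e)\<^sup>2) \<in> borel_measurable (P \<Otimes>\<^sub>M P)" for n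
        by (intro borel_measurable_sum borel_measurable_integrable integrable_coord_u_sq)
      show "integrable (P \<Otimes>\<^sub>M P) (\<lambda>z. (norm (R (u z)))\<^sup>2)" by (rule integrable_norm_u_sq)
      have "(\<lambda>n. \<Sum>e\<in>F n. (R (u z) \<bullet> e)\<^sup>2) \<longlonglongrightarrow> (norm (R (u z)))\<^sup>2" for z
        using Parseval[OF E, of "R (u z)" "R (u z)"] flim
        unfolding has_sum_def power2_norm_eq_inner power2_eq_square[symmetric]
        by (rule filterlim_compose)
      then show "AE z in P \<Otimes>\<^sub>M P. (\<lambda>n. \<Sum>e\<in>F n. (R (u z) \<bullet> e)\<^sup>2) \<longlonglongrightarrow> (norm (R (u z)))\<^sup>2" by simp
      have "(\<Sum>e\<in>F n. (R (u z) \<bullet> e)\<^sup>2) \<le> (norm (R (u z)))\<^sup>2" for n z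
        by (rule Bessel_inequality[OF oE F])
      then show "AE z in P \<Otimes>\<^sub>M P. norm (\<Sum>e\<in>F n. (R (u z) \<bullet> e)\<^sup>2) \<le> (norm (R (u z)))\<^sup>2" for n
        by (simp add: sum_nonneg)
    qed
    have eq: "(\<integral>z. (\<Sum>e\<in>F n. (R (u z) \<bullet> e)\<^sup>2) \<partial>(P \<Otimes>\<^sub>M P)) = sum ?f (F n)" for n
      by (rule Bochner_Integration.integral_sum) (rule integrable_coord_u_sq)
    have "(\<integral>z. (\<Sum>e\<in>F n. (R (u z) \<bullet> e)\<^sup>2) \<partial>(P \<Otimes>\<^sub>M P)) \<le> a" for n
      unfolding eq by (rule finite_sum_le_has_sum[OF a F]) simp
    then show ?thesis using lim by (intro LIMSEQ_le_const2[OF lim]) blast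
  qed
  ultimately show ?thesis using a by simp
qed

text \<open>Polarisation of the quadratic case, applied to \<open>R + S\<close> and
  \<open>R - S\<close>.\<close>

lemma has_sum_integral_coord:
  fixes R S :: "'h \<Rightarrow>\<^sub>L 'h"
  assumes E: "orthonormal_basis E"
  shows "((\<lambda>e. \<integral>z. (blinfun_apply R (u z) \<bullet> e) * (blinfun_apply S (u z) \<bullet> e) \<partial>(P \<Otimes>\<^sub>M P)) has_sum
    (\<integral>z. blinfun_apply R (u z) \<bullet> blinfun_apply S (u z) \<partial>(P \<Otimes>\<^sub>M P))) E"
proof -
  have "((\<lambda>e. (1/4) * (\<integral>z. ((R + S) (u z) \<bullet> e)\<^sup>2 \<partial>(P \<Otimes>\<^sub>M P)) + (-1/4) * (\<integral>z. ((R - S) (u z) \<bullet> e)\<^sup>2 \<partial>(P \<Otimes>\<^sub>M P)))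
    has_sum ((1/4) * (\<integral>z. (norm ((R + S) (u z)))\<^sup>2 \<partial>(P \<Otimes>\<^sub>M P)) + (-1/4) * (\<integral>z. (norm ((R - S) (u z)))\<^sup>2 \<partial>(P \<Otimes>\<^sub>M P)))) E"
    by (intro has_sum_add has_sum_cmult_right has_sum_integral_coord_sq[OF E])
  moreover have "(1/4) * (\<integral>z. ((R + S) (u z) \<bullet> e)\<^sup>2 \<partial>(P \<Otimes>\<^sub>M P)) + (-1/4) * (\<integral>z. ((R - S) (u z) \<bullet> e)\<^sup>2 \<partial>(P \<Otimes>\<^sub>M P))
      = (\<integral>z. (R (u z) \<bullet> e) * (S (u z) \<bullet> e) \<partial>(P \<Otimes>\<^sub>M P))" for e
  proof -
    have "(\<integral>z. (R (u z) \<bullet> e) * (S (u z) \<bullet> e) \<partial>(P \<Otimes>\<^sub>M P)) =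
        (\<integral>z. (1/4) * ((R + S) (u z) \<bullet> e)\<^sup>2 + (-1/4) * ((R - S) (u z) \<bullet> e)\<^sup>2 \<partial>(P \<Otimes>\<^sub>M P))"
      by (intro Bochner_Integration.integral_cong refl)
        (simp add: blinfun.add_left blinfun.diff_left inner_simps power2_eq_square algebra_simps)
    then show ?thesis using integrable_coord_u_sq[of "R + S" e] integrable_coord_u_sq[of "R - S" e] by simp
  qed
  moreover have "(1/4) * (\<integral>z. (norm ((R + S) (u z)))\<^sup>2 \<partial>(P \<Otimes>\<^sub>M P)) + (-1/4) * (\<integral>z. (norm ((R - S) (u z)))\<^sup>2 \<partial>(P \<Otimes>\<^sub>M P))
      = (\<integral>z. R (u z) \<bullet> S (u z) \<partial>(P \<Otimes>\<^sub>M P))"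
  proof -
    have "(\<integral>z. R (u z) \<bullet> S (u z) \<partial>(P \<Otimes>\<^sub>M P)) =
        (\<integral>z. (1/4) * (norm ((R + S) (u z)))\<^sup>2 + (-1/4) * (norm ((R - S) (u z)))\<^sup>2 \<partial>(P \<Otimes>\<^sub>M P))"
      by (intro Bochner_Integration.integral_cong refl)
        (simp add: power2_norm_eq_inner blinfun.add_left blinfun.diff_left inner_simps inner_commute algebra_simps)
    then show ?thesis using integrable_norm_u_sq[of "R + S"] integrable_norm_u_sq[of "R - S"] by simp
  qed
  ultimately show ?thesis by simp
qed

end

section \<open>Whitened operators\<close>

lemma SUP_supnorm_bound:
  assumes "ereal C = (SUP i. supnorm (f i))"
  shows "\<bar>f i x\<bar> \<le> C"
proof -
  have "ereal \<bar>f i x\<bar> \<le> supnorm (f i)" unfolding supnorm_def by (rule SUP_upper) simp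
  also have "\<dots> \<le> (SUP i. supnorm (f i))" by (rule SUP_upper) simp
  finally show ?thesis using assms by (metis ereal_less_eq(3))
qed

section \<open>The regularised inverse square root and the whitened covariance\<close>

locale rkhs_whitened = rkhs_prob +
  fixes l :: real
  assumes l_pos: "l > 0"
begin

interpretation PP: pair_prob_space P P ..

abbreviation "B \<equiv> inv_op (sqrt_op (Sigma0_reg evf P l))"
abbreviation "A \<equiv> whiten evf P l (Sigma0 evf P)"

lemma Sigma0_reg_apply: "Sigma0_reg evf P l f = \<Sigma> f + l *\<^sub>R f"
  by (simp add: Sigma0_reg_def blinfun.add_left blinfun.scaleR_left)

text \<open>The regularised operator is coercive with constant \<open>l\<close> because the
  covariance is positive, so \<open>sqrt_op_inverse\<close> applies.\<close>

lemma B_adj: "B f \<bullet> g = f \<bullet> B g"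
  and B_reg_B: "B (Sigma0_reg evf P l (B f)) = f"
  and B_B_reg: "B (B (Sigma0_reg evf P l f)) = f"
proof -
  have pos: "pos_op (Sigma0_reg evf P l)"
    using pos_Sigma0 l_pos by (auto simp: pos_op_def Sigma0_reg_apply inner_simps)
  have "l * (norm f)\<^sup>2 \<le> Sigma0_reg evf P l f \<bullet> f" for f
    using pos_Sigma0 by (auto simp: pos_op_def Sigma0_reg_apply inner_simps power2_norm_eq_inner)
  note * = sqrt_op_inverse[OF pos l_pos this]
  show "B f \<bullet> g = f \<bullet> B g" "B (Sigma0_reg evf P l (B f)) = f" "B (B (Sigma0_reg evf P l f)) = f"
    by (rule *)+
qed

lemma whiten_apply: "whiten evf P l T f = B (T (B f))"
  by (simp add: whiten_def)

lemma Sigma0_adj: "\<Sigma> f \<bullet> g = f \<bullet> \<Sigma> g"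
  using pos_Sigma0 by (simp add: pos_op_def)

lemma A_adj: "A f \<bullet> g = f \<bullet> A g"
  by (simp add: whiten_apply B_adj Sigma0_adj)

lemma A_eq: "A f = f - l *\<^sub>R B (B f)"
  using B_reg_B[of f] by (simp add: whiten_apply Sigma0_reg_apply blinfun.add_right blinfun.scaleR_right algebra_simps)

lemma A_nonneg: "0 \<le> A f \<bullet> f"
proof -
  have "A f \<bullet> f = \<Sigma> (B f) \<bullet> B f" by (simp add: whiten_apply B_adj)
  then show ?thesis using pos_Sigma0 unfolding pos_op_def by metis
qed

lemma inner_BB: "B (B f) \<bullet> f = (norm (B f))\<^sup>2"
  by (simp add: B_adj power2_norm_eq_inner)

lemma A_le: "A f \<bullet> f \<le> (norm f)\<^sup>2"
  using l_pos by (simp add: A_eq inner_diff_left inner_BB power2_norm_eq_inner)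

text \<open>Positivity of \<open>A\<close>, read through \<open>A_eq\<close>.\<close>

lemma norm_B: "(norm (B f))\<^sup>2 \<le> (norm f)\<^sup>2 / l"
  using A_nonneg[of f] l_pos
  by (simp add: A_eq inner_diff_left inner_BB power2_norm_eq_inner[symmetric] field_simps)

text \<open>The Hilbert-Schmidt product of \<open>A\<close> with half the rank-one operator
  \<open>tensor_op (B (u z)) (B (u z))\<close>, that is, the share of a single pair of
  observations.\<close>

definition h :: "'a \<times> 'a \<Rightarrow> real" where "h z = (1/2) * (A (B (u z)) \<bullet> B (u z))"

definition \<theta> :: real where "\<theta> = (\<integral>z. h z \<partial>(P \<Otimes>\<^sub>M P))"

lemma h_nonneg: "0 \<le> h z"
  using A_nonneg by (simp add: h_def)

lemma h_le_half: "h z \<le> (1/2) * (norm (B (u z)))\<^sup>2"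
  using A_le[of "B (u z)"] by (simp add: h_def)

lemma h_le: "h z \<le> 2 * \<kappa> / l"
proof -
  have "(norm (u z))\<^sup>2 \<le> (2 * sqrt \<kappa>)\<^sup>2" by (rule power_mono[OF norm_u norm_ge_zero])
  then have "(norm (u z))\<^sup>2 / l \<le> 4 * \<kappa> / l"
    using l_pos kappa_nonneg by (simp add: power_mult_distrib divide_right_mono)
  then show ?thesis using h_le_half[of z] norm_B[of "u z"] by simp
qed

lemma borel_measurable_h [measurable]: "h \<in> borel_measurable (P \<Otimes>\<^sub>M P)"
  using integrable_inner_u[of "A o\<^sub>L B" B, THEN borel_measurable_integrable]
  by (simp add: h_def[abs_def])

text \<open>The very basis chosen inside \<open>trace_op\<close> and \<open>hs_inner\<close>, so
  that these unfold to sums over \<open>E\<close> without an argument on independence of the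
  basis.\<close>

definition E :: "'b set" where "E = (SOME E. orthonormal_basis E)"

lemma onb_E: "orthonormal_basis E"
  unfolding E_def using orthonormal_basis_exists by (rule someI_ex)

lemma A_diag: "A f \<bullet> f = (1/2) * (\<integral>z. (B (u z) \<bullet> f)\<^sup>2 \<partial>(P \<Otimes>\<^sub>M P))"
proof -
  have "A f \<bullet> f = B f \<bullet> \<Sigma> (B f)" by (simp add: whiten_apply B_adj Sigma0_adj)
  also have "\<dots> = (1/2) * (\<integral>z. (B f \<bullet> u z) * (B f \<bullet> u z) \<partial>(P \<Otimes>\<^sub>M P))" by (rule inner_Sigma0_pair)
  finally show ?thesis by (simp add: B_adj power2_eq_square inner_commute[of f])
qed

lemma N1_eq: "N1 evf P l = (1/2) * (\<integral>z. (norm (B (u z)))\<^sup>2 \<partial>(P \<Otimes>\<^sub>M P))"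
  unfolding N1_def trace_op_def E_def[symmetric] A_diag
  by (intro infsumI has_sum_cmult_right has_sum_integral_coord_sq onb_E)

text \<open>The eigenvectors are unrelated to the basis \<open>E\<close> behind \<open>N1\<close>.
  The integral in \<open>N1_eq\<close> no longer mentions a basis, so Bessel's inequality compares
  the two.\<close>

lemma sum_A_le_N1:
  assumes "orthonormal F" "finite F"
  shows "(\<Sum>e\<in>F. A e \<bullet> e) \<le> N1 evf P l"
  using sum_integral_coord_le[OF assms, of B] by (simp add: A_diag N1_eq sum_divide_distrib[symmetric])

text \<open>Unfolding only one of the two factors as \<open>B (\<Sigma> (B e))\<close> exposes the
  covariance between \<open>B (A e)\<close> and \<open>B e\<close>; the pair formula then yields a
  mixed integrated Parseval sum, whose total is the mean of \<open>h\<close>.\<close>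

lemma has_sum_A_sq: "((\<lambda>e. A e \<bullet> A e) has_sum \<theta>) E"
proof -
  have "A e \<bullet> A e = (1/2) * (\<integral>z. ((A o\<^sub>L B) (u z) \<bullet> e) * (B (u z) \<bullet> e) \<partial>(P \<Otimes>\<^sub>M P))" for e
  proof -
    have "A e \<bullet> A e = B (A e) \<bullet> \<Sigma> (B e)" by (simp add: whiten_apply[of _ e] B_adj)
    also have "\<dots> = (1/2) * (\<integral>z. (B (A e) \<bullet> u z) * (B e \<bullet> u z) \<partial>(P \<Otimes>\<^sub>M P))" by (rule inner_Sigma0_pair)
    also have "(\<lambda>z. (B (A e) \<bullet> u z) * (B e \<bullet> u z)) = (\<lambda>z. ((A o\<^sub>L B) (u z) \<bullet> e) * (B (u z) \<bullet> e))"
      by (rule ext) (simp add: B_adj A_adj inner_commute[of e])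
    finally show ?thesis .
  qed
  moreover have "\<theta> = (1/2) * (\<integral>z. (A o\<^sub>L B) (u z) \<bullet> B (u z) \<partial>(P \<Otimes>\<^sub>M P))"
    by (simp add: \<theta>_def h_def)
  ultimately show ?thesis
    using has_sum_cmult_right[OF has_sum_integral_coord[OF onb_E, of "A o\<^sub>L B" B], of "1/2"]
    by (simp only:)
qed

lemma theta_nonneg: "0 \<le> \<theta>"
  using has_sum_A_sq by (rule has_sum_nonneg) simp

lemma N2_sq: "(N2 evf P l)\<^sup>2 = \<theta>"
  unfolding N2_def hs_norm_def hs_inner_def E_def[symmetric] infsumI[OF has_sum_A_sq]
  using theta_nonneg by simp

text \<open>Cauchy-Schwarz for each coordinate \<open>v \<bullet> A e\<close>, summed over
  \<open>E\<close>: the operator norm is dominated by the Hilbert-Schmidt norm.\<close>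

lemma norm_A_le: "(norm (A v))\<^sup>2 \<le> (norm v)\<^sup>2 * \<theta>"
proof (rule has_sum_mono)
  show "((\<lambda>e. (A v \<bullet> e) * (A v \<bullet> e)) has_sum (norm (A v))\<^sup>2) E"
    using Parseval[OF onb_E] by (simp add: power2_norm_eq_inner)
  show "((\<lambda>e. (norm v)\<^sup>2 * (A e \<bullet> A e)) has_sum ((norm v)\<^sup>2 * \<theta>)) E"
    by (rule has_sum_cmult_right[OF has_sum_A_sq])
  fix e
  have "(A v \<bullet> e) * (A v \<bullet> e) = (v \<bullet> A e)\<^sup>2" by (simp add: A_adj power2_eq_square)
  also have "\<dots> \<le> (v \<bullet> v) * (A e \<bullet> A e)" by (rule Cauchy_Schwarz_ineq)
  finally show "(A v \<bullet> e) * (A v \<bullet> e) \<le> (norm v)\<^sup>2 * (A e \<bullet> A e)" by (simp add: power2_norm_eq_inner)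
qed

lemma I_stat_eq: "I_stat evf K P l s Y = U_stat h s Y - \<theta>"
proof -
  define c where "c = 1 / (2 * real s * (real s - 1))"
  define U where "U i j = u (Y i, Y j)" for i j
  let ?S = "\<lambda>F. \<Sum>i\<in>{1..s}. \<Sum>j\<in>{1..s} - {i}. F i j"
  have hat: "Sigma_hat evf K s Y f = c *\<^sub>R ?S (\<lambda>i j. (U i j \<bullet> f) *\<^sub>R U i j)" for f
    unfolding Sigma_hat_def
    by (simp add: c_def U_def u_def blinfun.scaleR_left blinfun.sum_left tensor_op_apply)
  have summand: "A e \<bullet> whiten evf P l (Sigma_hat evf K s Y - \<Sigma>) e =
      c * ?S (\<lambda>i j. (A (B (U i j)) \<bullet> e) * (B (U i j) \<bullet> e)) + (-1) * (A e \<bullet> A e)" for e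
  proof -
    have "whiten evf P l (Sigma_hat evf K s Y - \<Sigma>) e = B (Sigma_hat evf K s Y (B e)) - A e"
      by (simp add: whiten_apply blinfun.diff_left blinfun.diff_right)
    moreover have "B (Sigma_hat evf K s Y (B e)) = c *\<^sub>R ?S (\<lambda>i j. (B (U i j) \<bullet> e) *\<^sub>R B (U i j))"
      by (simp add: hat blinfun.scaleR_right blinfun.sum_right B_adj)
    moreover have "A e \<bullet> B (U i j) = A (B (U i j)) \<bullet> e" for i j
      using A_adj[of "B (U i j)" e] by (simp only: inner_commute)
    ultimately show ?thesis by (simp add: inner_diff_right inner_sum_right mult.commute)
  qed
  have "((\<lambda>e. A e \<bullet> whiten evf P l (Sigma_hat evf K s Y - \<Sigma>) e) has_sum
      (c * ?S (\<lambda>i j. A (B (U i j)) \<bullet> B (U i j)) + (-1) * \<theta>)) E"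
    unfolding summand
    by (intro has_sum_add has_sum_cmult_right has_sum_finite_sum Parseval onb_E has_sum_A_sq) auto
  then have "I_stat evf K P l s Y = c * ?S (\<lambda>i j. A (B (U i j)) \<bullet> B (U i j)) + (-1) * \<theta>"
    unfolding I_stat_def hs_inner_def E_def[symmetric] by (rule infsumI)
  \<comment> \<open>The 1/2 inside \<open>h\<close> absorbs the 2 in the normalisation of
    \<open>Sigma_hat\<close>, which leaves the mean over ordered pairs.\<close>
  also have "?S (\<lambda>i j. A (B (U i j)) \<bullet> B (U i j)) = 2 * ?S (\<lambda>i j. h (Y i, Y j))"
    by (simp add: h_def U_def sum_distrib_left)
  also have "c * (2 * ?S (\<lambda>i j. h (Y i, Y j))) = U_stat h s Y"
    by (simp add: U_stat_def c_def)
  finally show ?thesis by simp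
qed

lemma I_stat_concentration:
  assumes b: "AE z in P \<Otimes>\<^sub>M P. h z \<le> b" and \<theta>: "\<theta> > 0" and s: "s \<ge> 2" and \<delta>: "0 < \<delta>"
  shows "measure (Pi\<^sub>M {1..s} (\<lambda>_. P)) {Y \<in> space (Pi\<^sub>M {1..s} (\<lambda>_. P)).
    \<bar>I_stat evf K P l s Y\<bar> \<le> 2 * b * ln (2 / \<delta>) / real s + sqrt (6 * b * (N2 evf P l)\<^sup>2 * ln (2 / \<delta>) / real s)} \<ge> 1 - \<delta>"
proof (cases "\<delta> < 1")
  case True
  then show ?thesis unfolding I_stat_eq N2_sq
    using U_stat_Bernstein[OF borel_measurable_h h_nonneg h_le b _ \<theta> s \<delta>] by (simp add: \<theta>_def)
next
  case False
  \<comment> \<open>For \<delta> at least 1 the claimed lower bound is not positive.\<close>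
  then show ?thesis using measure_nonneg[of "Pi\<^sub>M {1..s} (\<lambda>_. P)"] by (meson diff_le_0_iff_le not_less order_trans)
qed

end

section \<open>Eigenfunctions\<close>

locale rkhs_eigen = rkhs_whitened +
  fixes lam :: "nat \<Rightarrow> real" and phit :: "nat \<Rightarrow> 'a \<Rightarrow> real"
  assumes eigen: "eigen_expansion P (T_op evf P) lam phit"
begin

interpretation PP: pair_prob_space P P ..

lemma lam_pos: "0 < lam i"
  and L2_phit: "phit i \<in> L2_space P"
  and phit_orthonormal: "L2_inner P (phit i) (phit j) = (if i = j then 1 else 0)"
  and T_expansion: "g \<in> L2_space P \<Longrightarrow>
    (\<lambda>n. L2_norm P (\<lambda>x. T_op evf P g x - (\<Sum>i<n. lam i * L2_inner P (phit i) g * phit i x))) \<longlonglongrightarrow> 0"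
  using eigen unfolding eigen_expansion_def by auto

text \<open>The eigenfunction \<open>eigfun evf P lam phit i\<close> before division by
  \<open>lam i\<close>; its squared norm turns out to be \<open>lam i\<close>.\<close>

definition a :: "nat \<Rightarrow> 'b" where "a i = incl_adj evf P (phit i)"

lemma inner_a: "f \<bullet> a i = L2_inner P (incl evf P f) (phit i)"
  unfolding a_def by (rule incl_adj[OF L2_phit])

text \<open>Applied to \<open>phit i\<close>, the expansion of \<open>T_op\<close> has a single
  nonzero term, so the sequence of errors is constant past \<open>i\<close> and its limit 0 is
  already its value.\<close>

lemma incl_a_AE: "AE x in P. incl evf P (a i) x = lam i * phit i x"
proof -
  have "(\<Sum>j<n. lam j * L2_inner P (phit j) (phit i) * phit j x) = lam i * phit i x" if "n > i" for n x
  proof -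
    have "(\<Sum>j<n. lam j * L2_inner P (phit j) (phit i) * phit j x) = (\<Sum>j<n. if j = i then lam i * phit i x else 0)"
      by (intro sum.cong) (auto simp: phit_orthonormal)
    then show ?thesis using that by simp
  qed
  then have "\<forall>\<^sub>F n in sequentially. L2_norm P (\<lambda>x. T_op evf P (phit i) x - (\<Sum>j<n. lam j * L2_inner P (phit j) (phit i) * phit j x))
      = L2_norm P (\<lambda>x. incl evf P (a i) x - lam i * phit i x)"
    by (intro eventually_sequentiallyI[of "Suc i"]) (simp add: T_op_def a_def)
  from Lim_transform_eventually[OF T_expansion[OF L2_phit] this]
  have "L2_norm P (\<lambda>x. incl evf P (a i) x - lam i * phit i x) = 0" by (simp add: LIMSEQ_const_iff)
  from L2_norm_eq_0_AE[OF L2_diff_scaled[OF L2_incl L2_phit] this] show ?thesis by simp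
qed

lemma L2_inner_incl_a:
  assumes g: "g \<in> borel_measurable P"
  shows "L2_inner P g (incl evf P (a i)) = lam i * L2_inner P g (phit i)"
proof -
  note [measurable] = L2_measurable[OF L2_phit]
  have "L2_inner P g (incl evf P (a i)) = L2_inner P g (\<lambda>x. lam i * phit i x)"
    by (rule L2_inner_cong_AE[OF incl_a_AE g]) auto
  also have "\<dots> = lam i * L2_inner P g (phit i)" by (simp add: L2_inner_def mult.left_commute[of _ "lam i"])
  finally show ?thesis .
qed

lemma inner_a_a: "a i \<bullet> a j = (if i = j then lam i else 0)"
  using inner_a[of "a i" j] L2_inner_incl_a[OF L2_measurable[OF L2_phit], of j i]
  by (auto simp: L2_inner_commute[of _ "phit j"] phit_orthonormal)

lemma Sigma0_a: "\<Sigma> (a i) = lam i *\<^sub>R a i"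
proof -
  have "f \<bullet> \<Sigma> (a i) = f \<bullet> (lam i *\<^sub>R a i)" for f
    by (simp add: inner_Sigma0 L2_inner_incl_a inner_a)
  from this[of "\<Sigma> (a i) - lam i *\<^sub>R a i"]
  have "(\<Sigma> (a i) - lam i *\<^sub>R a i) \<bullet> (\<Sigma> (a i) - lam i *\<^sub>R a i) = 0" by (simp add: inner_diff_right)
  then show ?thesis by simp
qed

text \<open>The \<open>phit i\<close> need not be complete, but the expansion shows that
  \<open>T_op\<close> kills \<open>incl evf P q\<close>. Since \<open>T_op\<close> is the embedding
  after its adjoint, the adjoint kills it too, and one more pairing with \<open>q\<close> kills the
  function itself.\<close>

lemma incl_orthogonal_complement:
  assumes q: "\<And>i. q \<bullet> a i = 0"
  shows "AE x in P. incl evf P q x = 0"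
proof -
  let ?g = "incl evf P q"
  let ?b = "incl_adj evf P ?g"
  have "L2_inner P (phit i) ?g = 0" for i using q[of i] by (simp add: inner_a L2_inner_commute[of _ ?g])
  then have "(\<lambda>n::nat. L2_norm P (incl evf P ?b)) \<longlonglongrightarrow> 0"
    using T_expansion[OF L2_incl[of q]] by (simp add: T_op_def)
  then have "L2_norm P (incl evf P ?b) = 0" by (simp add: LIMSEQ_const_iff)
  then have b0: "AE x in P. incl evf P ?b x = 0" by (rule L2_norm_eq_0_AE[OF L2_incl])
  have "?b \<bullet> ?b = L2_inner P ?g (incl evf P ?b)" using incl_adj[OF L2_incl] by (simp add: L2_inner_commute)
  also have "\<dots> = L2_inner P ?g (\<lambda>_. 0)" by (rule L2_inner_cong_AE[OF b0]) auto
  finally have "?b = 0" by (simp add: L2_inner_def)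
  then have "L2_inner P ?g ?g = 0" using incl_adj[OF L2_incl, of q q] by simp
  then show ?thesis by (intro L2_norm_eq_0_AE[OF L2_incl]) (simp add: L2_norm_def)
qed

definition e :: "nat \<Rightarrow> 'b" where "e i = (1 / sqrt (lam i)) *\<^sub>R a i"

lemma inner_e: "e i \<bullet> e j = (if i = j then 1 else 0)"
  using lam_pos[of i] by (auto simp: e_def inner_a_a real_sqrt_mult_self divide_simps)

lemma orthonormal_e: "orthonormal (range e)"
  unfolding orthonormal_def pairwise_def orthogonal_def
  using inner_e by (auto simp: norm_eq_1)

lemma Sigma0_e: "\<Sigma> (e i) = lam i *\<^sub>R e i"
  by (simp add: e_def blinfun.scaleR_right Sigma0_a)

text \<open>Only the square of \<open>B\<close> is evaluated on eigenvectors; this suffices because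
  both \<open>A\<close> and the norm of \<open>B f\<close> are expressed through it.\<close>

lemma BB_e: "B (B (e i)) = (1 / (lam i + l)) *\<^sub>R e i"
proof -
  have p: "lam i + l > 0" using lam_pos[of i] l_pos by simp
  have "Sigma0_reg evf P l (e i) = (lam i + l) *\<^sub>R e i"
    by (simp add: Sigma0_reg_apply Sigma0_e scaleR_add_left)
  then have "(lam i + l) *\<^sub>R B (B (e i)) = e i" using B_B_reg[of "e i"] by (simp add: blinfun.scaleR_right)
  then have "(1 / (lam i + l)) *\<^sub>R ((lam i + l) *\<^sub>R B (B (e i))) = (1 / (lam i + l)) *\<^sub>R e i" by simp
  then show ?thesis using p by simp
qed

lemma A_e: "A (e i) = (lam i / (lam i + l)) *\<^sub>R e i"
proof -
  have "1 - l * (1 / (lam i + l)) = lam i / (lam i + l)"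
    using lam_pos[of i] l_pos by (simp add: field_simps)
  then show ?thesis unfolding A_eq BB_e by (metis scaleR_left_diff_distrib scaleR_one scaleR_scaleR)
qed

text \<open>One positive eigenvalue makes \<open>A\<close> nonzero. The tail bound needs this
  because its variance proxy \<open>b * \<theta>\<close> appears in a denominator.\<close>

lemma theta_pos: "\<theta> > 0"
proof -
  have "e 0 \<bullet> e 0 = 1" by (simp add: inner_e)
  then have n: "norm (e 0) = 1" by (simp add: norm_eq_1)
  have "0 < (norm (A (e 0)))\<^sup>2" using lam_pos[of 0] l_pos n by (simp add: A_e)
  also have "\<dots> \<le> \<theta>" using norm_A_le[of "e 0"] n by simp
  finally show ?thesis .
qed

text \<open>A vector orthogonal to all eigenfunctions is almost surely constant, hence, being
  continuous, constant on the support of \<open>P\<close>.\<close>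

lemma AE_u_in_span: "AE z in P \<Otimes>\<^sub>M P. u z \<in> closure (span (range e))"
proof -
  let ?V = "closure (span (range e))"
  obtain S where S: "closed S" "AE x in P. x \<in> S"
    "\<And>c f x. continuous_on UNIV f \<Longrightarrow> AE x in P. f x = (c::real) \<Longrightarrow> x \<in> S \<Longrightarrow> f x = c"
    using support_exists by blast
  have "u (x, y) \<in> ?V" if xy: "x \<in> S" "y \<in> S" for x y
  proof -
    obtain p where p: "p \<in> ?V" "\<And>v. v \<in> ?V \<Longrightarrow> (u (x, y) - p) \<bullet> v = 0"
      using closed_subspace_projection[OF subspace_closure_span closed_closure] by blast
    \<comment> \<open>The residual \<open>q\<close> takes the same value at \<open>x\<close> and
      \<open>y\<close>, so it is orthogonal to \<open>u (x, y)\<close>; being orthogonal to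
      \<open>p\<close> as well, it is orthogonal to itself.\<close>
    define q where "q = u (x, y) - p"
    have "q \<bullet> a i = 0" for i
    proof -
      have "e i \<in> ?V" using subsetD[OF closure_subset span_base[OF rangeI]] .
      then have "q \<bullet> e i = 0" unfolding q_def by (rule p(2))
      then show ?thesis using lam_pos[of i] by (simp add: e_def)
    qed
    from incl_orthogonal_complement[OF this]
    have "AE x in P. q \<bullet> k x = expectation (\<lambda>y. q \<bullet> k y)" by (simp add: incl_eq)
    moreover have "continuous_on UNIV (\<lambda>x. q \<bullet> k x)" by (intro continuous_intros continuous_k)
    ultimately have "q \<bullet> k x = expectation (\<lambda>y. q \<bullet> k y)" "q \<bullet> k y = expectation (\<lambda>y. q \<bullet> k y)"
      using S(3)[of "\<lambda>x. q \<bullet> k x"] xy by blast+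
    then have "q \<bullet> u (x, y) = 0" by (simp add: u_def inner_diff_right)
    moreover have "q \<bullet> p = 0" unfolding q_def by (rule p(2)[OF p(1)])
    ultimately have "q \<bullet> q = 0" unfolding q_def by (simp add: inner_diff_right)
    then show ?thesis using p(1) by (simp add: q_def)
  qed
  moreover have "AE z in P \<Otimes>\<^sub>M P. fst z \<in> S \<and> snd z \<in> S"
  proof (rule PP.AE_pair_measure)
    have "S \<in> sets P" using S(1) sets_P by (simp add: borel_closed)
    then have "S \<times> S \<in> sets (P \<Otimes>\<^sub>M P)" by simp
    moreover have "{z \<in> space (P \<Otimes>\<^sub>M P). fst z \<in> S \<and> snd z \<in> S} = S \<times> S"
      using sets.sets_into_space[OF \<open>S \<in> sets P\<close>] by (auto simp: space_pair_measure)
    ultimately show "{z \<in> space (P \<Otimes>\<^sub>M P). fst z \<in> S \<and> snd z \<in> S} \<in> sets (P \<Otimes>\<^sub>M P)" by simp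
    show "AE x in P. AE y in P. fst (x, y) \<in> S \<and> snd (x, y) \<in> S" using S(2) by simp
  qed
  ultimately show ?thesis by (auto elim: eventually_mono)
qed

text \<open>In the eigenbasis the squared norm of \<open>B (u z)\<close> weights the squared
  coordinates by \<open>1 / (lam i + l)\<close>. Each squared coordinate is at most
  \<open>lam i * (4 * C\<^sup>2)\<close>, the 4 coming from a difference of two values bounded by
  \<open>C\<close>, and the remaining weights \<open>lam i / (lam i + l)\<close> are diagonal
  entries of \<open>A\<close>.\<close>

lemma h_le_N1:
  assumes C: "\<And>i x. \<bar>evf (eigfun evf P lam phit i) x\<bar> \<le> C"
  shows "AE z in P \<Otimes>\<^sub>M P. h z \<le> 2 * C\<^sup>2 * N1 evf P l"
  using AE_u_in_span
proof eventually_elim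
  case (elim z)
  have coord: "(u z \<bullet> e i)\<^sup>2 \<le> lam i * (4 * C\<^sup>2)" for i
  proof -
    let ?f = "\<lambda>x. evf (eigfun evf P lam phit i) x"
    have "e i = sqrt (lam i) *\<^sub>R eigfun evf P lam phit i"
    proof -
      have "sqrt (lam i) * (1 / lam i) = 1 / sqrt (lam i)"
        using lam_pos[of i] real_sqrt_mult_self[of "lam i"] by (simp add: field_simps)
      then show ?thesis by (simp add: e_def eigfun_def a_def)
    qed
    then have "u z \<bullet> e i = sqrt (lam i) * (?f (fst z) - ?f (snd z))"
      by (simp add: reproducing u_def inner_diff_left inner_commute algebra_simps)
    then have "(u z \<bullet> e i)\<^sup>2 = lam i * (?f (fst z) - ?f (snd z))\<^sup>2"
      using lam_pos[of i] by (simp add: power_mult_distrib)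
    moreover have "\<bar>?f (fst z) - ?f (snd z)\<bar> \<le> 2 * C" using C[of i "fst z"] C[of i "snd z"] by linarith
    then have "(?f (fst z) - ?f (snd z))\<^sup>2 \<le> 4 * C\<^sup>2"
      using power_mono[of "\<bar>?f (fst z) - ?f (snd z)\<bar>" "2 * C" 2] by (simp add: power_mult_distrib)
    ultimately show ?thesis using lam_pos[of i] by (simp add: mult_left_mono)
  qed
  \<comment> \<open>At \<open>f = u z\<close> this functional gives the squared norm of
    \<open>B (u z)\<close>, so it turns the vector expansion of \<open>u z\<close> into the scalar
    sum to be bounded.\<close>
  have "bounded_linear (\<lambda>f. B (B f) \<bullet> u z)"
    by (intro bounded_linear_inner_left_comp blinfun.bounded_linear_right bounded_linear_compose[of "blinfun_apply B"])
  from has_sum_bounded_linear[OF this orthonormal_expansion[OF orthonormal_e elim]]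
  have "((\<lambda>d. (u z \<bullet> d) * (B (B d) \<bullet> u z)) has_sum (norm (B (u z)))\<^sup>2) (range e)"
    by (simp add: blinfun.scaleR_right inner_BB)
  then have "(norm (B (u z)))\<^sup>2 \<le> 4 * C\<^sup>2 * N1 evf P l"
  proof (rule has_sum_le_finite_sums)
    fix F assume F: "finite F" "F \<subseteq> range e"
    have "(\<Sum>d\<in>F. (u z \<bullet> d) * (B (B d) \<bullet> u z)) \<le> (\<Sum>d\<in>F. 4 * C\<^sup>2 * (A d \<bullet> d))"
    proof (rule sum_mono)
      fix d assume "d \<in> F"
      then obtain i where d: "d = e i" using F by blast
      have "(u z \<bullet> d) * (B (B d) \<bullet> u z) = (u z \<bullet> e i)\<^sup>2 / (lam i + l)"
        by (simp add: d BB_e power2_eq_square inner_commute)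
      also have "\<dots> \<le> lam i * (4 * C\<^sup>2) / (lam i + l)"
        using coord lam_pos[of i] l_pos by (intro divide_right_mono) auto
      also have "\<dots> = 4 * C\<^sup>2 * (A d \<bullet> d)" by (simp add: d A_e inner_e)
      finally show "(u z \<bullet> d) * (B (B d) \<bullet> u z) \<le> 4 * C\<^sup>2 * (A d \<bullet> d)" .
    qed
    also have "\<dots> = 4 * C\<^sup>2 * (\<Sum>d\<in>F. A d \<bullet> d)" by (simp add: sum_distrib_left)
    also have "\<dots> \<le> 4 * C\<^sup>2 * N1 evf P l"
    proof (intro mult_left_mono sum_A_le_N1)
      show "orthonormal F" using orthonormal_e F(2) by (rule orthonormal_subset)
    qed (use F in auto)
    finally show "(\<Sum>d\<in>F. (u z \<bullet> d) * (B (B d) \<bullet> u z)) \<le> 4 * C\<^sup>2 * N1 evf P l" .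
  qed
  then show ?case using h_le_half[of z] by simp
qed

end

theorem lemmaA5:
  fixes evf :: "'h::{real_inner,complete_space} \<Rightarrow> 'x::second_countable_topology \<Rightarrow> real"
    and K :: "'x \<Rightarrow> 'x \<Rightarrow> real"
    and \<kappa> :: real
    and P0 :: "'x measure"
    and lam :: "nat \<Rightarrow> real"
    and phit :: "nat \<Rightarrow> 'x \<Rightarrow> real"
    and l :: real
    and s :: nat
  assumes P0: "prob_space P0" "sets P0 = sets borel"
    and rkhs: "is_rkhs evf K"
    and K_cont: "continuous_on UNIV (\<lambda>(x, y). K x y)"
    and K_bound: "\<forall>x. K x x \<le> \<kappa>"
    and eigen: "eigen_expansion P0 (T_op evf P0) lam phit"
    and l: "l > 0"
    and s: "s \<ge> 2"
  shows "(\<forall>\<delta>>0. measure (Pi\<^sub>M {1..s} (\<lambda>_. P0))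
             {Y \<in> space (Pi\<^sub>M {1..s} (\<lambda>_. P0)).
                \<bar>I_stat evf K P0 l s Y\<bar>
                  \<le> 4 * \<kappa> * ln (2 / \<delta>) / (l * real s)
                    + sqrt (12 * \<kappa> * (N2 evf P0 l)\<^sup>2 * ln (2 / \<delta>) / (l * real s))}
           \<ge> 1 - \<delta>)
       \<and> (\<forall>C::real. ereal C = (SUP i. supnorm (evf (eigfun evf P0 lam phit i))) \<longrightarrow>
           (\<forall>\<delta>>0. measure (Pi\<^sub>M {1..s} (\<lambda>_. P0))
             {Y \<in> space (Pi\<^sub>M {1..s} (\<lambda>_. P0)).
                \<bar>I_stat evf K P0 l s Y\<bar>
                  \<le> 4 * C\<^sup>2 * N1 evf P0 l * ln (2 / \<delta>) / real s
                    + sqrt (12 * C\<^sup>2 * N1 evf P0 l * (N2 evf P0 l)\<^sup>2 * ln (2 / \<delta>) / real s)}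
           \<ge> 1 - \<delta>))"
proof -
  interpret prob_space P0 by fact
  interpret rkhs_eigen P0 evf K \<kappa> l lam phit
    using P0 rkhs K_cont K_bound eigen l by unfold_locales auto
  show ?thesis
  proof (intro conjI allI impI)
    fix \<delta> :: real assume "\<delta> > 0"
    \<comment> \<open>With this \<open>b\<close>, the \<open>2 * b\<close> and \<open>6 * b\<close>
      of \<open>I_stat_concentration\<close> become \<open>4 * \<kappa> / l\<close> and
      \<open>12 * \<kappa> / l\<close>.\<close>
    have "AE z in P0 \<Otimes>\<^sub>M P0. h z \<le> 2 * \<kappa> / l" by (simp add: h_le)
    from I_stat_concentration[OF this theta_pos s \<open>\<delta> > 0\<close>]
    show "measure (Pi\<^sub>M {1..s} (\<lambda>_. P0)) {Y \<in> space (Pi\<^sub>M {1..s} (\<lambda>_. P0)).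
        \<bar>I_stat evf K P0 l s Y\<bar> \<le> 4 * \<kappa> * ln (2 / \<delta>) / (l * real s)
          + sqrt (12 * \<kappa> * (N2 evf P0 l)\<^sup>2 * ln (2 / \<delta>) / (l * real s))} \<ge> 1 - \<delta>"
      by (simp add: mult.assoc)
  next
    fix C \<delta> :: real
    assume C: "ereal C = (SUP i. supnorm (evf (eigfun evf P0 lam phit i)))" and "\<delta> > 0"
    from I_stat_concentration[OF h_le_N1[OF SUP_supnorm_bound[OF C]] theta_pos s \<open>\<delta> > 0\<close>]
    show "measure (Pi\<^sub>M {1..s} (\<lambda>_. P0)) {Y \<in> space (Pi\<^sub>M {1..s} (\<lambda>_. P0)).
        \<bar>I_stat evf K P0 l s Y\<bar> \<le> 4 * C\<^sup>2 * N1 evf P0 l * ln (2 / \<delta>) / real s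
          + sqrt (12 * C\<^sup>2 * N1 evf P0 l * (N2 evf P0 l)\<^sup>2 * ln (2 / \<delta>) / real s)} \<ge> 1 - \<delta>"
      by (simp add: mult.assoc)
  qed
qed

end
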